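(* Let $\Gamma$ be a connected simplicial graph which is tree-graded with respect to a collection of pieces $\mathcal{P}=\{\Gamma_i\}_{i\in I}$, with shortest path metric $d_\Gamma$ on its vertex set. Let $p\geq 1$. Suppose we are given a concave function $\rho':\mathbb{N}\to\mathbb{R}_{\geq 0}$ and maps $\psi_i:V(\Gamma_i)\to\ell^p(X_i)$ (for sets $X_i$) such that for all $i$ and all $x,y\in V(\Gamma_i)$, \[ \rho'(d_\Gamma(x,y))\leq\|\psi_i(x)-\psi_i(y)\|_p\leq d_\Gamma(x,y). \] If $p=1$, there is a map $\phi$ from $V(\Gamma)$ into an $\ell^1$ space with $\rho'(d_\Gamma(x,y))\preceq\|\phi(x)-\phi(y)\|_1\preceq d_\Gamma(x,y)$ for all vertices $x,y$. If $p>1$, then for every function $f:\mathbb{N}\to\mathbb{R}_{\geq 0}$ satisfying $(C_p)$ there is a map $\phi$ from $V(\Gamma)$ into an $\ell^p$ space with \[ \rho(d_\Gamma(x,y))\preceq\|\phi(x)-\phi(y)\|_p\preceq d_\Gamma(x,y) \] for all vertices $x,y$, where $\rho(n)=\min\{\rho'(n),f(n)\}$.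
   Context: A connected simplicial graph $\Gamma$ is tree-graded with respect to a collection $\{\Gamma_i\}_{i\in I}$ of non-empty connected subgraphs if (1) every vertex and every simple loop of $\Gamma$ is contained in some $\Gamma_i$, and (2) for $i\neq j$, $\Gamma_i\not\subseteq\Gamma_j$ and $|V(\Gamma_i)\cap V(\Gamma_j)|\leq 1$. No countability is assumed; $\ell^p(S)$ for an arbitrary set $S$ denotes countably supported functions $S\to\mathbb{R}$ with finite $\ell^p$ norm. A function $f:\mathbb{N}\to\mathbb{R}_{\geq0}$ is concave if it is non-decreasing and $f(n+m)-f(n)\leq f(n)-f(n-m)$ for $n\geq m$; it satisfies $(C_p)$ if it is concave and $\sum_{n\geq1}\frac1n\left(\frac{f(n)}{n}\right)^p<\infty$. $A\preceq B$ means $A\leq CB+C$ for a constant $C$ independent of $x,y$. *)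

theory Defs
  imports "HOL-Analysis.Analysis"
begin

definition simple_graph :: "'v set \<Rightarrow> ('v \<times> 'v) set \<Rightarrow> bool" where
  "simple_graph V E \<longleftrightarrow> E \<subseteq> V \<times> V \<and> sym E \<and> (\<forall>x. (x, x) \<notin> E)"

definition walk :: "'v set \<Rightarrow> ('v \<times> 'v) set \<Rightarrow> 'v list \<Rightarrow> bool" where
  "walk V E xs \<longleftrightarrow> xs \<noteq> [] \<and> set xs \<subseteq> V \<and>
     (\<forall>k. Suc k < length xs \<longrightarrow> (xs ! k, xs ! Suc k) \<in> E)"

definition graph_connected :: "'v set \<Rightarrow> ('v \<times> 'v) set \<Rightarrow> bool" where
  "graph_connected V E \<longleftrightarrow>
     (\<forall>x\<in>V. \<forall>y\<in>V. \<exists>xs. walk V E xs \<and> hd xs = x \<and> last xs = y)"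

definition graph_dist :: "'v set \<Rightarrow> ('v \<times> 'v) set \<Rightarrow> 'v \<Rightarrow> 'v \<Rightarrow> nat" where
  "graph_dist V E x y =
     (LEAST n. \<exists>xs. walk V E xs \<and> hd xs = x \<and> last xs = y \<and> length xs = Suc n)"

definition simple_loop :: "'v set \<Rightarrow> ('v \<times> 'v) set \<Rightarrow> 'v list \<Rightarrow> bool" where
  "simple_loop V E cs \<longleftrightarrow> length cs \<ge> 3 \<and> distinct cs \<and> set cs \<subseteq> V \<and>
     (\<forall>k < length cs. (cs ! k, cs ! (Suc k mod length cs)) \<in> E)"

definition loop_edges :: "'v list \<Rightarrow> ('v \<times> 'v) set" where
  "loop_edges cs = {(cs ! k, cs ! (Suc k mod length cs)) | k. k < length cs}"

definition subgraph :: "'v set \<Rightarrow> ('v \<times> 'v) set \<Rightarrow> 'v set \<Rightarrow> ('v \<times> 'v) set \<Rightarrow> bool" where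
  "subgraph Vi Ei V E \<longleftrightarrow> simple_graph Vi Ei \<and> Vi \<subseteq> V \<and> Ei \<subseteq> E"

definition tree_graded ::
  "'v set \<Rightarrow> ('v \<times> 'v) set \<Rightarrow> 'i set \<Rightarrow> ('i \<Rightarrow> 'v set) \<Rightarrow> ('i \<Rightarrow> ('v \<times> 'v) set) \<Rightarrow> bool" where
  "tree_graded V E I PV PE \<longleftrightarrow>
     simple_graph V E \<and> graph_connected V E \<and>
     (\<forall>i\<in>I. subgraph (PV i) (PE i) V E \<and> PV i \<noteq> {} \<and> graph_connected (PV i) (PE i)) \<and>
     (\<forall>v\<in>V. \<exists>i\<in>I. v \<in> PV i) \<and>
     (\<forall>cs. simple_loop V E cs \<longrightarrow> (\<exists>i\<in>I. set cs \<subseteq> PV i \<and> loop_edges cs \<subseteq> PE i)) \<and>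
     (\<forall>i\<in>I. \<forall>j\<in>I. i \<noteq> j \<longrightarrow>
        \<not> (PV i \<subseteq> PV j \<and> PE i \<subseteq> PE j) \<and>
        (\<forall>a b. a \<in> PV i \<inter> PV j \<and> b \<in> PV i \<inter> PV j \<longrightarrow> a = b))"

definition lp_space :: "'x set \<Rightarrow> real \<Rightarrow> ('x \<Rightarrow> real) set" where
  "lp_space S p = {f. (\<forall>x. x \<notin> S \<longrightarrow> f x = 0) \<and> countable {x. f x \<noteq> 0} \<and>
                      (\<lambda>x. \<bar>f x\<bar> powr p) summable_on S}"

definition lp_norm :: "'x set \<Rightarrow> real \<Rightarrow> ('x \<Rightarrow> real) \<Rightarrow> real" where
  "lp_norm S p f = (\<Sum>\<^sub>\<infinity>x\<in>S. \<bar>f x\<bar> powr p) powr (1 / p)"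

definition concave_fun :: "(nat \<Rightarrow> real) \<Rightarrow> bool" where
  "concave_fun f \<longleftrightarrow> (\<forall>n. f n \<ge> 0) \<and> mono f \<and>
     (\<forall>n m. m \<le> n \<longrightarrow> f (n + m) - f n \<le> f n - f (n - m))"

definition cond_Cp :: "real \<Rightarrow> (nat \<Rightarrow> real) \<Rightarrow> bool" where
  "cond_Cp p f \<longleftrightarrow> concave_fun f \<and>
     summable (\<lambda>n. (1 / real (Suc n)) * (f (Suc n) / real (Suc n)) powr p)"

end

theory Submission
  imports Defs
begin

text \<open>Adding each edge that lies in no piece as a two-point piece, every edge lies in exactly one
  piece. Deleting the edges inside a piece \<open>A\<close> leaves components that each meet \<open>A\<close> in a single
  vertex, which defines a projection onto \<open>A\<close>; moving along an edge changes only the projection to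
  the piece of that edge, and \<open>d x y\<close> is the sum over all pieces of the distances of the projections
  of \<open>x\<close> and \<open>y\<close>. For \<open>p = 1\<close> the direct sum of the given maps composed with the projections works
  because a concave function is subadditive.

  For \<open>p > 1\<close> this direct sum only sees the largest single piece between \<open>x\<close> and \<open>y\<close>. One may
  replace \<open>f\<close> by \<open>min \<rho>' f\<close>. One then adds a weighted embedding of the tree obtained by collapsing each
  piece to a ray according to the distance from its entry point seen from a root: a node at depth
  \<open>n\<close> above \<open>x\<close> gets the value \<open>\<xi> n = (\<Sum>k=1..n. f k / k powr (1 + 1/p))\<close>. Condition \<open>(C\<^sub>p)\<close> says
  that the \<open>p\<close>-th powers of the increments of \<open>\<xi>\<close> are summable, which makes the tree part Lipschitz;
  and \<open>\<xi> n \<ge> f n / n powr (1/p)\<close>, so a branch of length \<open>n\<close> contributes about \<open>f n\<close>. Finally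
  \<open>d x y\<close> is at most the length of the two branches plus the distance in the single piece where
  the paths to \<open>x\<close> and \<open>y\<close> separate.\<close>

section \<open>Power sums and concave functions\<close>

text \<open>Jensen's inequality for \<open>t powr p\<close> with equal weights, applied to the
  strictly positive terms; putting the zero terms back only enlarges the cardinality factor.\<close>

lemma sum_powr_le_card_powr_sum:
  fixes c :: "'a \<Rightarrow> real"
  assumes p: "p \<ge> 1" and fin: "finite S" and nn: "\<And>k. k \<in> S \<Longrightarrow> c k \<ge> 0"
  shows "(\<Sum>k\<in>S. c k) powr p \<le> real (card S) powr (p - 1) * (\<Sum>k\<in>S. c k powr p)"
proof -
  define T where "T = {k \<in> S. c k > 0}"
  have T: "finite T" "T \<subseteq> S" using fin by (auto simp: T_def)
  have c0: "c k = 0" if "k \<in> S - T" for k using nn that by (force simp: T_def)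
  have eq: "(\<Sum>k\<in>S. c k) = (\<Sum>k\<in>T. c k)"
    using c0 fin T by (intro sum.mono_neutral_right) auto
  show ?thesis
  proof (cases "T = {}")
    case True
    then show ?thesis unfolding eq by (simp add: sum_nonneg)
  next
    case False
    let ?n = "real (card T)"
    have n: "?n > 0" using False T by (simp add: card_gt_0_iff)
    have "(\<Sum>k\<in>T. (1 / ?n) *\<^sub>R c k) powr p \<le> (\<Sum>k\<in>T. (1 / ?n) * c k powr p)"
      using n False T by (intro convex_on_sum[OF _ _ powr_convex[OF p]]) (auto simp: T_def)
    then have "(\<Sum>k\<in>T. c k) powr p / ?n powr p \<le> (\<Sum>k\<in>T. c k powr p) / ?n"
      using n by (simp add: sum_nonneg powr_divide nn T_def flip: sum_divide_distrib)
    then have "(\<Sum>k\<in>T. c k) powr p \<le> ?n powr (p - 1) * (\<Sum>k\<in>T. c k powr p)"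
      using n by (simp add: field_simps powr_diff)
    also have "\<dots> \<le> real (card S) powr (p - 1) * (\<Sum>k\<in>S. c k powr p)"
      using p T fin by (intro mult_mono powr_mono2 sum_mono2 sum_nonneg) (auto intro: card_mono)
    finally show ?thesis unfolding eq .
  qed
qed

text \<open>In \<open>t powr p = t * t powr (p - 1)\<close> the second factor is bounded by the
  power of the whole sum. This is what keeps a direct sum of Lipschitz maps Lipschitz.\<close>

lemma sum_powr_le_powr_sum:
  fixes c :: "'a \<Rightarrow> real"
  assumes p: "p \<ge> 1" and fin: "finite S" and nn: "\<And>k. k \<in> S \<Longrightarrow> c k \<ge> 0"
  shows "(\<Sum>k\<in>S. c k powr p) \<le> (\<Sum>k\<in>S. c k) powr p"
proof -
  let ?s = "\<Sum>k\<in>S. c k"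
  have le: "c k \<le> ?s" if "k \<in> S" for k using that fin nn by (intro member_le_sum) auto
  have split: "t powr p = t * t powr (p - 1)" if "t \<ge> 0" for t :: real
    using that by (cases "t = 0") (simp_all add: powr_diff)
  have "(\<Sum>k\<in>S. c k powr p) \<le> (\<Sum>k\<in>S. c k * ?s powr (p - 1))"
    using p nn le by (intro sum_mono) (auto simp: split intro!: mult_left_mono powr_mono2)
  also have "\<dots> = ?s powr p" using nn by (simp add: split sum_nonneg sum_distrib_right)
  finally show ?thesis .
qed

lemma abs_diff_powr_le:
  fixes a b :: real
  assumes "p \<ge> 1"
  shows "\<bar>a - b\<bar> powr p \<le> 2 powr (p - 1) * (\<bar>a\<bar> powr p + \<bar>b\<bar> powr p)"
proof -
  have "\<bar>a - b\<bar> powr p \<le> (\<bar>a\<bar> + \<bar>b\<bar>) powr p" using assms by (intro powr_mono2) auto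
  also have "\<dots> \<le> 2 powr (p - 1) * (\<bar>a\<bar> powr p + \<bar>b\<bar> powr p)"
    \<comment> \<open>The two-term case, indexed by \<open>bool\<close>.\<close>
    using sum_powr_le_card_powr_sum[of p "UNIV :: bool set" "\<lambda>t. if t then \<bar>a\<bar> else \<bar>b\<bar>"] assms
    by (simp add: UNIV_bool add.commute)
  finally show ?thesis .
qed

section \<open>Concave functions and condition (C_p)\<close>

lemma concave_fun_nonneg: "concave_fun f \<Longrightarrow> f n \<ge> 0"
  by (simp add: concave_fun_def)

lemma concave_fun_mono: "\<lbrakk>concave_fun f; m \<le> n\<rbrakk> \<Longrightarrow> f m \<le> f n"
  by (simp add: concave_fun_def monoD)

text \<open>The definition with step 1 compares neighbouring increments; induction chains these
  comparisons.\<close>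

lemma concave_fun_increments:
  assumes "concave_fun f" "m \<le> n"
  shows "f (Suc n) - f n \<le> f (Suc m) - f m"
  using assms(2)
proof (induction n rule: dec_induct)
  case (step n)
  have "f (Suc n + 1) - f (Suc n) \<le> f (Suc n) - f (Suc n - 1)"
    using assms(1) unfolding concave_fun_def by (elim conjE allE[of _ "Suc n"] allE[of _ 1]) simp
  then show ?case using step by simp
qed simp

text \<open>Increments taken from \<open>m\<close> on are at most those taken from 0 on, and
  \<open>f 0\<close> may be dropped because it is nonnegative.\<close>

lemma concave_fun_subadditive:
  assumes "concave_fun f"
  shows "f (m + n) \<le> f m + f n"
proof -
  have "f (m + n) - f m \<le> f n - f 0"
  proof (induction n)
    case (Suc n)
    then show ?case using concave_fun_increments[OF assms, of n "m + n"] by simp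
  qed simp
  then show ?thesis using concave_fun_nonneg[OF assms, of 0] by simp
qed

lemma concave_fun_sum:
  assumes "concave_fun f" "f 0 = 0" "finite S"
  shows "f (\<Sum>k\<in>S. c k) \<le> (\<Sum>k\<in>S. f (c k))"
  using assms(3)
proof (induction S)
  case (insert k S)
  then show ?case using concave_fun_subadditive[OF assms(1), of "c k" "\<Sum>k\<in>S. c k"] by simp
qed (simp add: assms)

lemma concave_fun_ratio:
  assumes f: "concave_fun f" and "0 < m" "m \<le> n"
  shows "f n / n \<le> f m / m"
  using assms(3)
proof (induction n rule: dec_induct)
  case (step n)
  \<comment> \<open>As \<open>f 0\<close> plus \<open>n\<close> increments, none smaller than the
    next one, \<open>f n\<close> is at least \<open>n\<close> times that next increment.\<close>
  have "real n * (f (Suc n) - f n) \<le> f n" for n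
  proof (induction n)
    case (Suc n)
    have "real (Suc n) * (f (Suc (Suc n)) - f (Suc n)) \<le> real (Suc n) * (f (Suc n) - f n)"
      using concave_fun_increments[OF f, of n "Suc n"] by (intro mult_left_mono) auto
    then show ?case using Suc by (simp add: algebra_simps)
  qed (simp add: concave_fun_nonneg f)
  from this[of n] have "f (Suc n) / Suc n \<le> f n / n"
    using step assms by (simp add: field_simps)
  then show ?case using step by simp
qed simp

text \<open>If \<open>f\<close> attains the minimum at \<open>n\<close>, its values bound the
  minimum at \<open>n + m\<close> and \<open>n - m\<close> from above, so the inequality for
  \<open>f\<close> suffices; likewise for \<open>g\<close>.\<close>

lemma concave_fun_min:
  assumes "concave_fun f" "concave_fun g"
  shows "concave_fun (\<lambda>n. min (f n) (g n))"
proof -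
  have "min (f (n + m)) (g (n + m)) - min (f n) (g n) \<le> min (f n) (g n) - min (f (n - m)) (g (n - m))"
    if "m \<le> n" for n m
  proof -
    have "f (n + m) - f n \<le> f n - f (n - m)" "g (n + m) - g n \<le> g n - g (n - m)"
      using assms that unfolding concave_fun_def by auto
    then show ?thesis by (auto simp: min_def split: if_splits)
  qed
  moreover have "mono (\<lambda>n. min (f n) (g n))"
    using assms by (intro monoI min.mono) (auto dest: concave_fun_mono)
  ultimately show ?thesis using assms by (auto simp: concave_fun_def)
qed

lemma cond_Cp_min:
  assumes f: "cond_Cp p f" and g: "concave_fun g" and p: "p \<ge> 1"
  shows "cond_Cp p (\<lambda>n. min (g n) (f n))"
proof -
  have cf: "concave_fun f" using f by (simp add: cond_Cp_def)
  have "summable (\<lambda>n. (1 / real (Suc n)) * (min (g (Suc n)) (f (Suc n)) / real (Suc n)) powr p)"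
  proof (rule summable_comparison_test')
    show "summable (\<lambda>n. (1 / real (Suc n)) * (f (Suc n) / real (Suc n)) powr p)"
      using f by (simp add: cond_Cp_def)
    fix n :: nat assume "0 \<le> n"
    show "norm ((1 / real (Suc n)) * (min (g (Suc n)) (f (Suc n)) / real (Suc n)) powr p)
        \<le> (1 / real (Suc n)) * (f (Suc n) / real (Suc n)) powr p"
      using concave_fun_nonneg[OF cf] concave_fun_nonneg[OF g] p
      by (auto simp: abs_mult intro!: divide_right_mono powr_mono2 simp del: of_nat_Suc)
  qed
  then show ?thesis using concave_fun_min[OF g cf] by (simp add: cond_Cp_def)
qed

text \<open>The summands are the \<open>p\<close>-th roots of the terms of the series in
  \<open>cond_Cp\<close>, so that \<open>level_weight_increment\<close> recovers exactly that
  series.\<close>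

definition level_weight :: "real \<Rightarrow> (nat \<Rightarrow> real) \<Rightarrow> nat \<Rightarrow> real" where
  "level_weight p f n = (\<Sum>k<n. ((1 / real (Suc k)) * (f (Suc k) / real (Suc k)) powr p) powr (1 / p))"

lemma level_weight_0 [simp]: "level_weight p f 0 = 0"
  by (simp add: level_weight_def)

lemma level_weight_mono: "mono (level_weight p f)"
  unfolding level_weight_def by (intro monoI sum_mono2) auto

lemma level_weight_increment:
  assumes "p \<ge> 1" "concave_fun f"
  shows "(level_weight p f (Suc n) - level_weight p f n) powr p
    = (1 / real (Suc n)) * (f (Suc n) / real (Suc n)) powr p"
  using assms by (simp add: level_weight_def powr_powr)

text \<open>Both \<open>f k / k\<close> and \<open>1 / k\<close> decrease in \<open>k\<close>, so
  each of the \<open>n\<close> summands is at least the last one, \<open>?t\<close>.\<close>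

lemma level_weight_ge:
  assumes p: "p \<ge> 1" and f: "concave_fun f" "f 0 = 0"
  shows "f n powr p \<le> real n * level_weight p f n powr p"
proof (cases "n = 0")
  case True then show ?thesis using f by simp
next
  case False
  let ?t = "((1 / real n) * (f n / n) powr p) powr (1 / p)"
  have "real n * ?t = (\<Sum>k<n. ?t)" by simp
  also have "\<dots> \<le> level_weight p f n"
    unfolding level_weight_def
  proof (rule sum_mono)
    fix k assume "k \<in> {..<n}"
    then have "f n / n \<le> f (Suc k) / Suc k" "1 / real n \<le> 1 / Suc k"
      using concave_fun_ratio[OF f(1), of "Suc k" n] by (auto simp: field_simps)
    then show "?t \<le> ((1 / real (Suc k)) * (f (Suc k) / real (Suc k)) powr p) powr (1 / p)"
      using p concave_fun_nonneg[OF f(1)] by (intro powr_mono2 mult_mono) auto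
  qed
  finally have "real n * (real n * ?t) powr p \<le> real n * level_weight p f n powr p"
    using p by (intro mult_left_mono powr_mono2) auto
  \<comment> \<open>Here \<open>(n * ?t) powr p\<close> is \<open>f n powr p / n\<close>, and the
    factor \<open>n\<close> in front cancels the denominator.\<close>
  also have "real n * (real n * ?t) powr p = f n powr p"
    using False p concave_fun_nonneg[OF f(1)]
    by (simp add: powr_mult powr_powr powr_divide)
  finally show ?thesis .
qed

section \<open>Projections onto pieces\<close>

lemma walk_imp_relpow:
  assumes "walk V E xs" "length xs = Suc n"
  shows "(hd xs, last xs) \<in> E ^^ n"
proof -
  have "xs \<noteq> []" using assms by auto
  then have "hd xs = xs ! 0" "last xs = xs ! n" using assms by (auto simp: hd_conv_nth last_conv_nth)
  then show ?thesis using assms unfolding relpow_fun_conv walk_def by auto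
qed

lemma relpow_imp_walk:
  assumes "E \<subseteq> V \<times> V" "x \<in> V" "(x, y) \<in> E ^^ n"
  shows "\<exists>xs. walk V E xs \<and> hd xs = x \<and> last xs = y \<and> length xs = Suc n"
proof -
  from assms(3) obtain f where f: "f 0 = x" "f n = y" "\<And>i. i < n \<Longrightarrow> (f i, f (Suc i)) \<in> E"
    unfolding relpow_fun_conv by auto
  have fV: "f i \<in> V" if "i \<le> n" for i
    using that f assms(1,2) by (cases i) (auto simp: Suc_le_eq)
  let ?xs = "map f [0..<Suc n]"
  have "walk V E ?xs" unfolding walk_def using f(3) fV by (auto simp del: upt_Suc)
  moreover have "hd ?xs = x" "last ?xs = y" using f by (auto simp: hd_map last_map hd_conv_nth simp del: upt_Suc)
  ultimately show ?thesis by (intro exI[of _ ?xs]) auto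
qed

lemma relpow_symI:
  assumes "sym R" "(x, y) \<in> R ^^ n" shows "(y, x) \<in> R ^^ n"
  using assms(2)
proof (induction n arbitrary: y)
  case (Suc n)
  then obtain z where "(x, z) \<in> R ^^ n" "(z, y) \<in> R" by auto
  then have "(y, z) \<in> R" "(z, x) \<in> R ^^ n" using Suc.IH assms(1) by (auto dest: symD)
  then show ?case by (rule relpow_Suc_I2)
qed auto

lemma relpow_segment:
  assumes "\<And>i. i < n \<Longrightarrow> (f i, f (Suc i)) \<in> R" "j \<le> k" "k \<le> n"
  shows "(f j, f k) \<in> R ^^ (k - j)"
  unfolding relpow_fun_conv using assms by (intro exI[of _ "\<lambda>i. f (j + i)"]) auto

text \<open>Cutting out the stretch between two visits to the same vertex would give a shorter
  chain.\<close>

lemma shortest_chain_inj: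
  assumes "\<And>i. i < n \<Longrightarrow> (f i, f (Suc i)) \<in> R"
    and min: "\<And>m. (f 0, f n) \<in> R ^^ m \<Longrightarrow> n \<le> m"
  shows "inj_on f {..n}"
proof (rule linorder_inj_onI)
  fix i j :: nat assume ij: "i < j" "i \<in> {..n}" "j \<in> {..n}"
  show "f i \<noteq> f j"
  proof
    assume eq: "f i = f j"
    have "(f 0, f i) \<in> R ^^ (i - 0)" "(f j, f n) \<in> R ^^ (n - j)"
      using relpow_segment[of n f R 0 i, OF assms(1)] relpow_segment[of n f R j n, OF assms(1)] ij by auto
    then have "(f 0, f n) \<in> R ^^ (i + (n - j))" unfolding relpow_add eq by auto
    from min[OF this] show False using ij by auto
  qed
qed auto

text \<open>Pieces are recorded by their vertex sets alone, and the edges of a piece are all edges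
  of \<open>E\<close> with both ends in it. \<open>edge_cover\<close> is what the added two-point
  pieces provide.\<close>

locale piece_graph =
  fixes V :: "'v set" and E :: "('v \<times> 'v) set" and P :: "'v set set"
  assumes E_V: "E \<subseteq> V \<times> V" and symE: "sym E"
    and connected: "\<lbrakk>x \<in> V; y \<in> V\<rbrakk> \<Longrightarrow> (x, y) \<in> E\<^sup>*"
    and piece_V: "A \<in> P \<Longrightarrow> A \<subseteq> V" and piece_ne: "A \<in> P \<Longrightarrow> A \<noteq> {}"
    and piece_connected: "\<lbrakk>A \<in> P; x \<in> A; y \<in> A\<rbrakk> \<Longrightarrow> (x, y) \<in> (E \<inter> A \<times> A)\<^sup>*"
    and piece_inter: "\<lbrakk>A \<in> P; B \<in> P; x \<in> A; y \<in> A; x \<in> B; y \<in> B; x \<noteq> y\<rbrakk> \<Longrightarrow> A = B"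
    and edge_cover: "(x, y) \<in> E \<Longrightarrow> \<exists>A\<in>P. x \<in> A \<and> y \<in> A"
    and loop_cover: "simple_loop V E cs \<Longrightarrow> \<exists>A\<in>P. set cs \<subseteq> A"
begin

abbreviation d :: "'v \<Rightarrow> 'v \<Rightarrow> nat" where "d \<equiv> graph_dist V E"

section \<open>The path metric\<close>

lemma graph_dist_relpow: "x \<in> V \<Longrightarrow> d x y = (LEAST n. (x, y) \<in> E ^^ n)"
  unfolding graph_dist_def
  using walk_imp_relpow[of V E] relpow_imp_walk[OF E_V, of x y]
  by (intro arg_cong[where f = Least] ext) blast

lemma d_le: "\<lbrakk>x \<in> V; (x, y) \<in> E ^^ n\<rbrakk> \<Longrightarrow> d x y \<le> n"
  by (simp add: graph_dist_relpow Least_le)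

lemma d_relpow: "\<lbrakk>x \<in> V; y \<in> V\<rbrakk> \<Longrightarrow> (x, y) \<in> E ^^ d x y"
  using connected[of x y] by (auto simp: graph_dist_relpow rtrancl_power intro: LeastI)

lemma d_triangle: "\<lbrakk>x \<in> V; y \<in> V; z \<in> V\<rbrakk> \<Longrightarrow> d x z \<le> d x y + d y z"
  using d_relpow[of x y] d_relpow[of y z] by (intro d_le) (auto simp: relpow_add)

lemma d_sym: "\<lbrakk>x \<in> V; y \<in> V\<rbrakk> \<Longrightarrow> d x y = d y x"
  by (meson antisym d_le d_relpow relpow_symI symE)

lemma d_self [simp]: "x \<in> V \<Longrightarrow> d x x = 0"
  using d_le[of x x 0] by simp

lemma d_eq_0: "\<lbrakk>x \<in> V; y \<in> V\<rbrakk> \<Longrightarrow> d x y = 0 \<longleftrightarrow> x = y"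
  using d_relpow[of x y] by auto

lemma d_edge: "(x, y) \<in> E \<Longrightarrow> d x y \<le> 1"
  using E_V by (intro d_le) auto

lemma geodesic_step:
  assumes "x \<in> V" "y \<in> V" "d x y = Suc n"
  obtains z where "(x, z) \<in> E" "z \<in> V" "d z y = n"
proof -
  have "(x, y) \<in> E ^^ Suc n" using d_relpow[of x y] assms by simp
  then obtain z where z: "(x, z) \<in> E" "(z, y) \<in> E ^^ n" by (meson relpow_Suc_D2)
  then have "z \<in> V" using E_V by auto
  moreover have "d z y \<le> n" using z d_le \<open>z \<in> V\<close> by auto
  moreover have "d x y \<le> 1 + d z y" using d_triangle[of x z y] d_edge[OF z(1)] assms \<open>z \<in> V\<close> by simp
  ultimately show thesis using that z assms by simp
qed

text \<open>A shortest path joining two vertices of \<open>A\<close> without the edges of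
  \<open>A\<close>, closed up by a shortest path inside \<open>A\<close>, is a simple loop. The
  piece containing this loop shares two vertices with \<open>A\<close>, hence equals
  \<open>A\<close>, yet the loop has a vertex outside \<open>A\<close>.\<close>

lemma piece_separated:
  assumes A: "A \<in> P" and "u \<in> A" "w \<in> A" "(u, w) \<in> (E - A \<times> A)\<^sup>*"
  shows "u = w"
proof (rule ccontr)
  assume "u \<noteq> w"
  let ?R = "E - A \<times> A"
  \<comment> \<open>The minimum ranges over all pairs of distinct vertices of \<open>A\<close>, so
    an interior vertex in \<open>A\<close> would give a shorter path for another pair.\<close>
  define Q where "Q n \<longleftrightarrow> (\<exists>u\<in>A. \<exists>w\<in>A. u \<noteq> w \<and> (u, w) \<in> ?R ^^ n)" for n
  have ex: "\<exists>n. Q n" using assms \<open>u \<noteq> w\<close> unfolding Q_def rtrancl_power by blast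
  define n where "n = (LEAST n. Q n)"
  have "Q n" unfolding n_def using ex by (rule LeastI_ex)
  then obtain u w where uw: "u \<in> A" "w \<in> A" "u \<noteq> w" "(u, w) \<in> ?R ^^ n" unfolding Q_def by blast
  have least: "n \<le> m" if "u' \<in> A" "w' \<in> A" "u' \<noteq> w'" "(u', w') \<in> ?R ^^ m" for u' w' m
    unfolding n_def by (rule Least_le) (use that Q_def in blast)
  from uw(4) obtain f where f: "f 0 = u" "f n = w" "\<And>i. i < n \<Longrightarrow> (f i, f (Suc i)) \<in> ?R"
    unfolding relpow_fun_conv by auto
  have f_inj: "inj_on f {..n}"
    by (rule shortest_chain_inj[of n f ?R, OF f(3)]) (use least uw f in auto)
  have f_out: "f i \<notin> A" if i: "0 < i" "i < n" for i
  proof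
    assume fi: "f i \<in> A"
    show False
    proof (cases "f i = u")
      case True
      have "(f i, f n) \<in> ?R ^^ (n - i)" using relpow_segment[of n f ?R i n, OF f(3)] i by simp
      then show False using least[of "f i" w "n - i"] fi uw f True i by auto
    next
      case False
      have "(f 0, f i) \<in> ?R ^^ (i - 0)" using relpow_segment[of n f ?R 0 i, OF f(3)] i by simp
      then show False using least[of u "f i" i] fi uw f False i by auto
    qed
  qed
  have "n \<noteq> 0" using f(1,2) uw(3) by metis
  \<comment> \<open>A single step would be an edge with both ends in \<open>A\<close>, which
    \<open>?R\<close> excludes.\<close>
  moreover have "n \<noteq> 1" using f(3)[of 0] f(1,2) uw(1,2) by auto
  ultimately have n2: "2 \<le> n" by simp
  let ?S = "E \<inter> A \<times> A"
  define m where "m = (LEAST m. (w, u) \<in> ?S ^^ m)"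
  have "\<exists>m. (w, u) \<in> ?S ^^ m" using piece_connected[OF A uw(2,1)] by (simp add: rtrancl_power)
  then have "(w, u) \<in> ?S ^^ m" unfolding m_def by (rule LeastI_ex)
  then obtain g where g: "g 0 = w" "g m = u" "\<And>i. i < m \<Longrightarrow> (g i, g (Suc i)) \<in> ?S"
    unfolding relpow_fun_conv by auto
  have g_inj: "inj_on g {..m}"
    by (rule shortest_chain_inj[of m g ?S, OF g(3)]) (use g in \<open>auto simp: m_def intro: Least_le\<close>)
  have g_in: "g i \<in> A" if "i < m" for i using g(3)[OF that] by auto
  have "m \<noteq> 0" using g(1,2) uw(3) by metis
  \<comment> \<open>Each list stops before its last vertex, because \<open>f n = g 0\<close> and
    \<open>g m = f 0\<close>.\<close>
  let ?cs = "map f [0..<n] @ map g [0..<m]"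
  have nth: "?cs ! k = (if k < n then f k else g (k - n))" if "k < n + m" for k
    using that by (auto simp: nth_append)
  have "distinct ?cs"
  proof -
    have "f i \<noteq> g j" if "i < n" "j < m" for i j
    proof (cases "i = 0")
      case True
      have "g m \<noteq> g j" using that g_inj by (auto dest: inj_onD)
      then show ?thesis using True f g by simp
    next
      case False
      then show ?thesis using f_out[of i] g_in[of j] that by auto
    qed
    moreover have "inj_on f {0..<n}" "inj_on g {0..<m}"
      using f_inj g_inj by (auto elim!: inj_on_subset)
    ultimately show ?thesis by (auto simp: distinct_map)
  qed
  moreover have "(?cs ! k, ?cs ! (Suc k mod length ?cs)) \<in> E" if "k < length ?cs" for k
  proof -
    have k: "k < n + m" using that by simp
    consider "Suc k < n" | "Suc k = n" | "n \<le> k" "Suc k < n + m" | "Suc k = n + m" using k by linarith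
    then show ?thesis
    proof cases
      case 1 then show ?thesis using f(3)[of k] k by (simp add: nth)
    next
      case 2 then show ?thesis using f(3)[of k] f g k \<open>m \<noteq> 0\<close> by (simp add: nth)
    next
      case 3 then show ?thesis using g(3)[of "k - n"] k by (simp add: nth Suc_diff_le)
    next
      case 4
      then have "g (Suc (k - n)) = f 0" using f g \<open>m \<noteq> 0\<close> by (simp add: Suc_diff_le[symmetric])
      then show ?thesis using g(3)[of "k - n"] k 4 n2 \<open>m \<noteq> 0\<close> by (simp add: nth)
    qed
  qed
  moreover have "set ?cs \<subseteq> V" using f(3) g(3) E_V by fastforce
  ultimately have "simple_loop V E ?cs"
    unfolding simple_loop_def using n2 \<open>m \<noteq> 0\<close> by auto
  then obtain B where B: "B \<in> P" "set ?cs \<subseteq> B" using loop_cover by blast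
  have "f i \<in> B" if "i < n" for i using B(2) that by auto
  from this[of 0] this[of 1] have "u \<in> B" "f 1 \<in> B" using n2 f(1) by auto
  moreover have "w \<in> B" using B(2) \<open>m \<noteq> 0\<close> g(1) by force
  ultimately have "A = B" using piece_inter[OF A B(1)] uw by blast
  then show False using f_out[of 1] n2 \<open>f 1 \<in> B\<close> by simp
qed

text \<open>The description is unique by \<open>piece_separated\<close>. By
  \<open>dist_via_proj\<close> it picks the vertex of \<open>A\<close> nearest to
  \<open>x\<close>.\<close>

definition proj :: "'v set \<Rightarrow> 'v \<Rightarrow> 'v" where
  "proj A x = (THE a. a \<in> A \<and> (x, a) \<in> (E - A \<times> A)\<^sup>*)"

lemma sym_outside: "sym (E - A \<times> A)"
  using symE by (auto simp: sym_def)

lemma proj_eqI: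
  assumes "A \<in> P" "a \<in> A" "(x, a) \<in> (E - A \<times> A)\<^sup>*"
  shows "proj A x = a"
  unfolding proj_def
proof (rule the_equality)
  fix b assume b: "b \<in> A \<and> (x, b) \<in> (E - A \<times> A)\<^sup>*"
  have "(a, x) \<in> (E - A \<times> A)\<^sup>*" using symD[OF sym_rtrancl[OF sym_outside] assms(3)] .
  then have "(a, b) \<in> (E - A \<times> A)\<^sup>*" using b by auto
  then show "b = a" using piece_separated[OF assms(1,2)] b by blast
qed (use assms in auto)

text \<open>Until a path first enters \<open>A\<close>, each of its edges starts outside
  \<open>A\<close> and so survives the deletion.\<close>

lemma proj_reach:
  assumes A: "A \<in> P" and x: "x \<in> V"
  shows "proj A x \<in> A \<and> (x, proj A x) \<in> (E - A \<times> A)\<^sup>*"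
proof -
  obtain a where a: "a \<in> A" using piece_ne[OF A] by blast
  have "(x, a) \<in> E\<^sup>*" using connected x a piece_V[OF A] by blast
  then have "\<exists>b\<in>A. (x, b) \<in> (E - A \<times> A)\<^sup>*"
  proof (induction rule: converse_rtrancl_induct)
    case base then show ?case using a by blast
  next
    case (step y z)
    show ?case
    proof (cases "y \<in> A")
      case True then show ?thesis by blast
    next
      case False
      then have "(y, z) \<in> E - A \<times> A" using step by blast
      then show ?thesis using step.IH by (meson converse_rtrancl_into_rtrancl)
    qed
  qed
  then show ?thesis using proj_eqI[OF A] by blast
qed

lemma proj_in: "\<lbrakk>A \<in> P; x \<in> V\<rbrakk> \<Longrightarrow> proj A x \<in> A"
  using proj_reach by blast

lemma proj_V: "\<lbrakk>A \<in> P; x \<in> V\<rbrakk> \<Longrightarrow> proj A x \<in> V"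
  using proj_in piece_V by blast

lemma proj_id: "\<lbrakk>A \<in> P; x \<in> A\<rbrakk> \<Longrightarrow> proj A x = x"
  by (rule proj_eqI) auto

lemma proj_edge:
  assumes "A \<in> P" "(x, y) \<in> E" "\<not> (x \<in> A \<and> y \<in> A)"
  shows "proj A x = proj A y"
proof -
  have "y \<in> V" using assms E_V by auto
  then have "proj A y \<in> A" "(y, proj A y) \<in> (E - A \<times> A)\<^sup>*" using proj_reach assms by auto
  moreover have "(x, y) \<in> E - A \<times> A" using assms by blast
  ultimately show ?thesis using proj_eqI[OF assms(1)] by (meson converse_rtrancl_into_rtrancl)
qed

text \<open>Along the walk the projection stays fixed until the walk enters \<open>A\<close>, where
  it stands at its own projection. So every walk into \<open>A\<close> passes through
  \<open>proj A x\<close>.\<close>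

lemma dist_via_proj_walk:
  assumes A: "A \<in> P" "u \<in> A"
  shows "\<lbrakk>x \<in> V; (x, u) \<in> E ^^ n\<rbrakk> \<Longrightarrow> d x (proj A x) + d (proj A x) u \<le> n"
proof (induction n arbitrary: x)
  case 0 then show ?case using A proj_id by simp
next
  case (Suc n)
  show ?case
  proof (cases "x \<in> A")
    case True
    then have "proj A x = x" using A proj_id by simp
    then show ?thesis using Suc.prems d_le by simp
  next
    case False
    obtain z where z: "(x, z) \<in> E" "(z, u) \<in> E ^^ n" using Suc.prems by (meson relpow_Suc_D2)
    have zV: "z \<in> V" using z E_V by auto
    have eq: "proj A x = proj A z" using proj_edge A z False by blast
    have "d x (proj A z) \<le> d x z + d z (proj A z)"
      using d_triangle Suc.prems zV proj_V A by simp
    then show ?thesis using Suc.IH[OF zV z(2)] d_edge[OF z(1)] eq by simp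
  qed
qed

lemma dist_via_proj:
  assumes "A \<in> P" "u \<in> A" "x \<in> V"
  shows "d x u = d x (proj A x) + d (proj A x) u"
proof -
  have u: "u \<in> V" using assms piece_V by auto
  have "d x (proj A x) + d (proj A x) u \<le> d x u"
    using dist_via_proj_walk assms d_relpow u by blast
  moreover have "d x u \<le> d x (proj A x) + d (proj A x) u" using d_triangle proj_V assms u by simp
  ultimately show ?thesis by simp
qed

text \<open>Since the projections differ, the walk must enter \<open>A\<close>, first at
  \<open>proj A x\<close>; from there \<open>dist_via_proj\<close>, read from \<open>y\<close>,
  accounts for the rest.\<close>

lemma dist_through_piece_walk:
  assumes A: "A \<in> P" and y: "y \<in> V"
  shows "\<lbrakk>x \<in> V; (x, y) \<in> E ^^ n; proj A x \<noteq> proj A y\<rbrakk>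
    \<Longrightarrow> d x (proj A x) + d (proj A x) (proj A y) + d (proj A y) y \<le> n"
proof (induction n arbitrary: x)
  case 0 then show ?case by simp
next
  case (Suc n)
  show ?case
  proof (cases "x \<in> A")
    case True
    then have "proj A x = x" using A proj_id by simp
    moreover have "d y x = d y (proj A y) + d (proj A y) x" using dist_via_proj A True y by simp
    ultimately show ?thesis using Suc.prems d_le d_sym proj_V A y by (metis add_0 add.commute d_self)
  next
    case False
    obtain z where z: "(x, z) \<in> E" "(z, y) \<in> E ^^ n" using Suc.prems by (meson relpow_Suc_D2)
    have zV: "z \<in> V" using z E_V by auto
    have eq: "proj A x = proj A z" using proj_edge A z False by blast
    have "d x (proj A z) \<le> d x z + d z (proj A z)"
      using d_triangle Suc.prems zV proj_V A by simp
    then show ?thesis using Suc.IH[OF zV z(2)] Suc.prems d_edge[OF z(1)] eq by simp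
  qed
qed

lemma dist_through_piece:
  assumes "A \<in> P" "x \<in> V" "y \<in> V" "proj A x \<noteq> proj A y"
  shows "d x (proj A x) + d (proj A x) (proj A y) + d (proj A y) y \<le> d x y"
  using dist_through_piece_walk assms d_relpow by blast

text \<open>No edge of \<open>A\<close> with distinct ends has both ends in \<open>B\<close>, so
  \<open>proj B\<close> is constant along paths inside \<open>A\<close>.\<close>

lemma proj_const_on_piece:
  assumes "A \<in> P" "B \<in> P" "A \<noteq> B" "x \<in> A" "y \<in> A"
  shows "proj B x = proj B y"
  using piece_connected[OF assms(1,4,5)]
proof (induction rule: rtrancl_induct)
  case (step y z)
  have "proj B y = proj B z"
  proof (cases "y \<in> B \<and> z \<in> B")
    case True
    then have "y = z" using piece_inter[of A B y z] assms step by auto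
    then show ?thesis by simp
  next
    case False
    then show ?thesis using proj_edge assms step by blast
  qed
  then show ?case using step by simp
qed auto

text \<open>Here \<open>a\<close> is the image of \<open>B\<close> in \<open>A\<close>, and
  \<open>b\<close> that of \<open>A\<close> in \<open>B\<close>. The alternative propagates along a
  path out of \<open>A\<close>: an edge changing \<open>proj A\<close> lies in \<open>A\<close>,
  where \<open>proj B\<close> is \<open>b\<close>, and vice versa.\<close>

lemma proj_dichotomy:
  assumes A: "A \<in> P" and B: "B \<in> P" and "A \<noteq> B"
  obtains a b where "\<And>x. x \<in> B \<Longrightarrow> proj A x = a" "\<And>x. x \<in> A \<Longrightarrow> proj B x = b"
    "\<And>x. x \<in> V \<Longrightarrow> proj A x = a \<or> proj B x = b"
proof -
  obtain a0 b0 where 0: "a0 \<in> A" "b0 \<in> B" using piece_ne A B by blast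
  define a where "a = proj A b0"
  define b where "b = proj B a0"
  have a: "proj A x = a" if "x \<in> B" for x
    unfolding a_def using that proj_const_on_piece[OF B A] assms 0 by blast
  have b: "proj B x = b" if "x \<in> A" for x
    unfolding b_def using that proj_const_on_piece[OF A B] assms 0 by blast
  have "proj A x = a \<or> proj B x = b" if x: "x \<in> V" for x
  proof -
    have "(x, a0) \<in> E\<^sup>*" using connected x 0 piece_V[OF A] by blast
    then show ?thesis
    proof (induction rule: converse_rtrancl_induct)
      case base then show ?case using 0 b by blast
    next
      case (step y z)
      then show ?case using a b proj_edge[OF A] proj_edge[OF B] by metis
    qed
  qed
  with a b that show thesis by blast
qed

text \<open>By \<open>proj_dichotomy\<close> two of the three vertices would have equal projections
  to \<open>A\<close>, or equal projections to \<open>B\<close>.\<close>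

lemma triple_proj_unique:
  assumes "A \<in> P" "B \<in> P" "x \<in> V" "y \<in> V" "z \<in> V"
    and "distinct [proj A x, proj A y, proj A z]" "distinct [proj B x, proj B y, proj B z]"
  shows "A = B"
proof (rule ccontr)
  assume "A \<noteq> B"
  then obtain a b where "\<And>x. x \<in> V \<Longrightarrow> proj A x = a \<or> proj B x = b"
    using proj_dichotomy assms(1,2) by metis
  from this[OF assms(3)] this[OF assms(4)] this[OF assms(5)] show False using assms(6,7) by auto
qed

section \<open>Distance as a sum over the separating pieces\<close>

definition sep :: "'v \<Rightarrow> 'v \<Rightarrow> 'v set set" where
  "sep x y = {A \<in> P. proj A x \<noteq> proj A y}"

lemma edge_piece:
  assumes "(x, y) \<in> E"
  obtains A where "A \<in> P" "x \<in> A" "y \<in> A" "\<And>B. \<lbrakk>B \<in> P; B \<noteq> A\<rbrakk> \<Longrightarrow> proj B x = proj B y"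
proof -
  obtain A where A: "A \<in> P" "x \<in> A" "y \<in> A" using edge_cover assms by blast
  then have "proj B x = proj B y" if "B \<in> P" "B \<noteq> A" for B
    using proj_const_on_piece[of A B x y] that by blast
  then show thesis using that A by blast
qed

text \<open>Induction along a geodesic from \<open>x\<close>: its first edge lies in one piece
  \<open>A\<close> and changes only the summand of \<open>A\<close>.\<close>

lemma dist_sum_pieces:
  assumes "y \<in> V"
  shows "x \<in> V \<Longrightarrow> finite (sep x y) \<and> d x y = (\<Sum>A\<in>sep x y. d (proj A x) (proj A y))"
proof (induction "d x y" arbitrary: x)
  case 0
  then have "x = y" using d_eq_0 assms by simp
  then show ?case using assms by (simp add: sep_def)
next
  case (Suc n)
  obtain z where z: "(x, z) \<in> E" "z \<in> V" "d z y = n" using geodesic_step Suc assms by metis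
  obtain A where A: "A \<in> P" "x \<in> A" "z \<in> A" and
    eq: "\<And>B. \<lbrakk>B \<in> P; B \<noteq> A\<rbrakk> \<Longrightarrow> proj B x = proj B z" using edge_piece[OF z(1)] by metis
  have IH: "finite (sep z y)" "n = (\<Sum>B\<in>sep z y. d (proj B z) (proj B y))"
    using Suc.hyps(1) z by auto
  have px: "proj A x = x" "proj A z = z" using A proj_id by auto
  have pV: "proj A y \<in> V" using A assms proj_V by simp
  have "d y x = d y (proj A y) + d (proj A y) x" "d y z = d y (proj A y) + d (proj A y) z"
    using dist_via_proj A assms by auto
  \<comment> \<open>All paths from \<open>y\<close> to the edge pass through
    \<open>proj A y\<close>, so the distance to \<open>proj A y\<close> drops by one together with
    the distance to \<open>y\<close>.\<close>
  then have step: "d x (proj A y) = Suc (d z (proj A y))"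
    using Suc.hyps(2) z d_sym Suc.prems assms pV by simp
  \<comment> \<open>The sets \<open>sep x y\<close> and \<open>sep z y\<close> can differ only in
    \<open>A\<close>; both sums are extended to \<open>?F\<close> by zero terms.\<close>
  let ?F = "insert A (sep z y)"
  have fin: "finite ?F" using IH by simp
  have sub: "sep x y \<subseteq> ?F" "sep z y \<subseteq> ?F"
  proof -
    show "sep x y \<subseteq> ?F"
    proof
      fix B assume "B \<in> sep x y"
      then show "B \<in> ?F" using eq[of B] by (cases "B = A") (auto simp: sep_def)
    qed
  qed blast
  have ext: "(\<Sum>B\<in>sep w y. d (proj B w) (proj B y)) = (\<Sum>B\<in>?F. d (proj B w) (proj B y))"
    if "w \<in> V" "sep w y \<subseteq> ?F" for w
    using that fin assms A proj_V by (intro sum.mono_neutral_left) (auto simp: sep_def)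
  have "(\<Sum>B\<in>?F. d (proj B x) (proj B y)) = d x (proj A y) + (\<Sum>B\<in>?F - {A}. d (proj B x) (proj B y))"
    using fin px by (subst sum.remove[of _ A]) auto
  also have "(\<Sum>B\<in>?F - {A}. d (proj B x) (proj B y)) = (\<Sum>B\<in>?F - {A}. d (proj B z) (proj B y))"
    using eq by (intro sum.cong) (auto simp: sep_def)
  also have "d x (proj A y) + \<dots> = Suc (\<Sum>B\<in>?F. d (proj B z) (proj B y))"
    using fin px step by (subst (2) sum.remove[of _ A]) auto
  finally have "(\<Sum>B\<in>sep x y. d (proj B x) (proj B y)) = Suc n"
    using ext[OF Suc.prems sub(1)] ext[OF z(2) sub(2)] IH(2) by simp
  then show ?case using Suc.hyps(2) finite_subset[OF sub(1) fin] by simp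
qed

end

section \<open>The collapsed tree\<close>

locale rooted_piece_graph = piece_graph V E P
  for V :: "'v set" and E :: "('v \<times> 'v) set" and P :: "'v set set" +
  fixes r :: 'v
  assumes r: "r \<in> V"
begin

definition entry_level :: "'v set \<Rightarrow> nat" where
  "entry_level A = d r (proj A r)"

text \<open>The position of the projection of \<open>x\<close> on the ray to which \<open>A\<close>
  is collapsed.\<close>

definition height :: "'v set \<Rightarrow> 'v \<Rightarrow> nat" where
  "height A x = d (proj A r) (proj A x)"

text \<open>\<open>nodes x\<close> is the branch of the collapsed tree from the root to the image of \<open>x\<close>; the node
  \<open>(A, k)\<close> lies at level \<open>entry_level A + k\<close>.\<close>

definition nodes :: "'v \<Rightarrow> ('v set \<times> nat) set" where
  "nodes x = {(A, k). A \<in> P \<and> 1 \<le> k \<and> k \<le> height A x}"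

text \<open>On \<open>nodes x\<close> the truncated subtraction is exact, by
  \<open>node_level_le\<close>. A node at level \<open>d r x\<close> has depth 0 and hence weight
  \<open>\<xi> 0\<close>.\<close>

definition depth :: "'v \<Rightarrow> 'v set \<times> nat \<Rightarrow> nat" where
  "depth x c = d r x - (entry_level (fst c) + snd c)"

definition tree_coord :: "(nat \<Rightarrow> real) \<Rightarrow> 'v \<Rightarrow> 'v set \<times> nat \<Rightarrow> real" where
  "tree_coord \<xi> x c = (if c \<in> nodes x then \<xi> (depth x c) else 0)"

lemma height_0_iff: "\<lbrakk>A \<in> P; x \<in> V\<rbrakk> \<Longrightarrow> height A x = 0 \<longleftrightarrow> proj A r = proj A x"
  unfolding height_def using d_eq_0 proj_V r by simp

lemma node_sep: "\<lbrakk>x \<in> V; (A, k) \<in> nodes x\<rbrakk> \<Longrightarrow> A \<in> P \<and> proj A r \<noteq> proj A x"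
  using height_0_iff[of A x] by (auto simp: nodes_def)

lemma finite_nodes: "x \<in> V \<Longrightarrow> finite (nodes x)"
proof -
  assume x: "x \<in> V"
  have "nodes x \<subseteq> Sigma (sep r x) (\<lambda>A. {1..height A x})"
    using node_sep[OF x] by (auto simp: nodes_def sep_def)
  moreover have "finite (sep r x)" using dist_sum_pieces[OF x r] by simp
  ultimately show ?thesis by (meson finite_SigmaI finite_atLeastAtMost finite_subset)
qed

lemma node_level_le:
  assumes "x \<in> V" "(A, k) \<in> nodes x"
  shows "entry_level A + k \<le> d r x"
proof -
  have A: "A \<in> P" "proj A r \<noteq> proj A x" using node_sep assms by blast+
  have "entry_level A + height A x \<le> d r x"
    using dist_through_piece[OF A(1) r assms(1) A(2)] by (simp add: entry_level_def height_def)
  then show ?thesis using assms by (simp add: nodes_def)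
qed

text \<open>A geodesic from \<open>r\<close> to \<open>x\<close> leaves one of the two pieces before
  it enters the other: the entry point of the later piece projects to the earlier one just as
  \<open>x\<close> does.\<close>

lemma piece_levels_disjoint:
  assumes x: "x \<in> V" and A: "A \<in> P" "proj A r \<noteq> proj A x" and B: "B \<in> P" "proj B r \<noteq> proj B x"
    and "A \<noteq> B"
  shows "entry_level B + height B x \<le> entry_level A \<or> entry_level A + height A x \<le> entry_level B"
proof -
  obtain a b where ab: "\<And>x. x \<in> B \<Longrightarrow> proj A x = a" "\<And>x. x \<in> A \<Longrightarrow> proj B x = b"
    "\<And>x. x \<in> V \<Longrightarrow> proj A x = a \<or> proj B x = b"
    using proj_dichotomy[OF A(1) B(1) \<open>A \<noteq> B\<close>] by metis
  have crossing: "entry_level B + height B x \<le> entry_level A"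
    if "A \<in> P" "B \<in> P" "proj B (proj A r) = proj B x" "proj B r \<noteq> proj B x" for A B
    using dist_through_piece[OF that(2) r proj_V[OF that(1) r]] that
    by (simp add: entry_level_def height_def)
  \<comment> \<open>Each piece separates \<open>r\<close> from \<open>x\<close>, so \<open>r\<close>
    and \<open>x\<close> cannot both project to \<open>a\<close>, nor both to
    \<open>b\<close>.\<close>
  consider "proj A r = a" "proj B x = b" | "proj B r = b" "proj A x = a"
    using ab(3)[OF r] ab(3)[OF x] A B by metis
  then show ?thesis
  proof cases
    case 1
    then have "proj B (proj A r) = proj B x" using ab(2)[OF proj_in[OF A(1) r]] by metis
    then show ?thesis using crossing[OF A(1) B(1) _ B(2)] by blast
  next
    case 2
    then have "proj A (proj B r) = proj A x" using ab(1)[OF proj_in[OF B(1) r]] by metis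
    then show ?thesis using crossing[OF B(1) A(1) _ A(2)] by blast
  qed
qed

text \<open>The nodes of \<open>x\<close> in \<open>A\<close> fill the levels above
  \<open>entry_level A\<close> up to \<open>entry_level A + height A x\<close>, and these ranges are
  disjoint for different pieces.\<close>

lemma inj_on_level:
  assumes "x \<in> V"
  shows "inj_on (\<lambda>c. entry_level (fst c) + snd c) (nodes x)"
proof (rule inj_onI, clarsimp)
  fix A k B l
  assume Ak: "(A, k) \<in> nodes x" and Bl: "(B, l) \<in> nodes x"
    and eq: "entry_level A + k = entry_level B + l"
  have "A = B"
  proof (rule ccontr)
    assume "A \<noteq> B"
    then have "entry_level B + height B x \<le> entry_level A \<or> entry_level A + height A x \<le> entry_level B"
      using piece_levels_disjoint[OF assms] node_sep[OF assms Ak] node_sep[OF assms Bl] by blast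
    moreover have "1 \<le> k" "k \<le> height A x" "1 \<le> l" "l \<le> height B x"
      using Ak Bl by (simp_all add: nodes_def)
    ultimately show False using eq by linarith
  qed
  then show "A = B \<and> k = l" using eq by simp
qed

lemma inj_on_depth:
  assumes "x \<in> V"
  shows "inj_on (depth x) (nodes x)"
proof (rule inj_onI)
  fix c c' assume c: "c \<in> nodes x" "c' \<in> nodes x" "depth x c = depth x c'"
  then have "entry_level (fst c) + snd c = entry_level (fst c') + snd c'"
    using node_level_le[OF assms, of "fst c" "snd c"] node_level_le[OF assms, of "fst c'" "snd c'"]
    by (simp add: depth_def)
  then show "c = c'" using inj_on_level[OF assms] c by (auto dest: inj_onD)
qed

text \<open>The nodes of \<open>x\<close> in one piece form an initial segment, so truncated
  subtraction counts those missing from the other branch.\<close>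

lemma card_nodes_diff:
  assumes "x \<in> V" "y \<in> V"
  shows "card (nodes x - nodes y) = (\<Sum>A\<in>sep x y. height A x - height A y)"
proof -
  have "nodes x - nodes y = Sigma (sep x y) (\<lambda>A. {height A y<..height A x})"
    by (auto simp: nodes_def sep_def height_def)
  moreover have "finite (sep x y)" using dist_sum_pieces assms by simp
  ultimately show ?thesis by simp
qed

text \<open>Only the piece at which the tripod on \<open>r, x, y\<close> branches can contribute a distance that the
  tree does not see.\<close>

lemma dist_le_branches:
  assumes x: "x \<in> V" and y: "y \<in> V"
  obtains D where "d x y \<le> card (nodes x - nodes y) + card (nodes y - nodes x) + D"
    and "D = 0 \<or> (\<exists>J\<in>sep x y. D = d (proj J x) (proj J y))"
proof -
  let ?F = "sep x y"
  let ?g = "\<lambda>A. d (proj A x) (proj A y)"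
  let ?b = "\<lambda>A. (height A x - height A y) + (height A y - height A x)"
  have fin: "finite ?F" and sum: "d x y = sum ?g ?F" using dist_sum_pieces x y by auto
  have "sep y x = ?F" by (auto simp: sep_def)
  then have cards: "card (nodes x - nodes y) + card (nodes y - nodes x) = sum ?b ?F"
    using card_nodes_diff x y by (simp add: sum.distrib)
  \<comment> \<open>If \<open>r\<close> projects to the same vertex as \<open>x\<close> or
    \<open>y\<close>, one height is zero and the other is the distance of the projections.\<close>
  have flat: "?g A \<le> ?b A" if "A \<in> ?F" "\<not> distinct [proj A r, proj A x, proj A y]" for A
  proof -
    have nd: "proj A r = proj A x \<or> proj A r = proj A y" and
      A: "A \<in> P" "proj A x \<noteq> proj A y" using that by (auto simp: sep_def)
    then consider "proj A r = proj A x" | "proj A r = proj A y" using nd by blast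
    then show ?thesis
    proof cases
      case 1
      then have "height A y = ?g A" by (simp add: height_def)
      then show ?thesis using height_0_iff[OF A(1) x] 1 by simp
    next
      case 2
      then have "height A x = ?g A" using d_sym proj_V A x y by (simp add: height_def)
      then show ?thesis using height_0_iff[OF A(1) y] 2 by simp
    qed
  qed
  show thesis
  proof (cases "\<exists>J\<in>?F. distinct [proj J r, proj J x, proj J y]")
    case False
    then have "sum ?g ?F \<le> sum ?b ?F" using flat by (intro sum_mono) blast
    then show ?thesis using that[of 0] sum cards by simp
  next
    case True
    then obtain J where J: "J \<in> ?F" "distinct [proj J r, proj J x, proj J y]" by blast
    have "sum ?g (?F - {J}) \<le> sum ?b (?F - {J})"
    proof (intro sum_mono flat)
      fix A assume A: "A \<in> ?F - {J}"
      show "\<not> distinct [proj A r, proj A x, proj A y]"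
        using triple_proj_unique[of A J r x y] A J r x y by (auto simp: sep_def simp del: distinct.simps)
    qed auto
    also have "\<dots> \<le> sum ?b ?F" using fin by (intro sum_mono2) auto
    finally have "sum ?g ?F \<le> sum ?b ?F + ?g J" using fin J by (simp add: sum.remove)
    then show ?thesis using that[of "?g J"] sum cards J by auto
  qed
qed

text \<open>Depths are distinct along a branch, so at most \<open>?m\<close> of the nodes have depth
  below \<open>?m\<close>. At least \<open>?m\<close> nodes remain, each contributing no less than
  \<open>\<xi> ?m powr p\<close>.\<close>

lemma tree_coord_ge:
  assumes x: "x \<in> V" and p: "p \<ge> 1" and mono: "mono \<xi>" and \<xi>0: "\<xi> 0 = 0"
    and ge: "\<And>n. f n powr p \<le> real n * \<xi> n powr p"
  shows "f (card (nodes x - nodes y) div 2) powr p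
    \<le> (\<Sum>c\<in>nodes x - nodes y. \<bar>tree_coord \<xi> x c - tree_coord \<xi> y c\<bar> powr p)"
proof -
  let ?Q = "nodes x - nodes y"
  let ?m = "card ?Q div 2"
  let ?S = "{c \<in> ?Q. ?m \<le> depth x c}"
  have fin: "finite ?Q" using finite_nodes x by simp
  have \<xi>nn: "\<xi> n \<ge> 0" for n using monoD[OF mono, of 0 n] \<xi>0 by simp
  have "inj_on (depth x) (?Q - ?S)" using inj_on_depth[OF x] by (rule inj_on_subset) auto
  then have "card (?Q - ?S) = card (depth x ` (?Q - ?S))" by (simp add: card_image)
  also have "\<dots> \<le> card {..<?m}" by (intro card_mono) auto
  finally have "card (?Q - ?S) \<le> ?m" by simp
  moreover have "?S \<subseteq> ?Q" by blast
  then have "card (?Q - ?S) = card ?Q - card ?S" by (intro card_Diff_subset finite_subset[OF _ fin])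
  ultimately have "?m \<le> card ?S" by linarith
  then have "real ?m * \<xi> ?m powr p \<le> real (card ?S) * \<xi> ?m powr p"
    by (intro mult_right_mono) auto
  also have "\<dots> = (\<Sum>c\<in>?S. \<xi> ?m powr p)" by simp
  also have "\<dots> \<le> (\<Sum>c\<in>?S. \<bar>tree_coord \<xi> x c - tree_coord \<xi> y c\<bar> powr p)"
    using p \<xi>nn mono
    by (intro sum_mono powr_mono2) (auto simp: tree_coord_def intro: monoD order_trans[OF _ abs_ge_self])
  also have "\<dots> \<le> (\<Sum>c\<in>?Q. \<bar>tree_coord \<xi> x c - tree_coord \<xi> y c\<bar> powr p)"
    using fin by (intro sum_mono2) auto
  finally show ?thesis using ge[of ?m] by simp
qed

lemma entry_height: "\<lbrakk>A \<in> P; x \<in> A\<rbrakk> \<Longrightarrow> d r x = entry_level A + height A x"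
  using dist_via_proj r proj_id by (simp add: entry_level_def height_def)

text \<open>An edge either stays on one level and changes nothing, or it climbs one level. Then the
  old nodes become deeper by one, and a new node has weight \<open>\<xi> 0 = 0\<close>.\<close>

lemma tree_coord_edge:
  assumes xy: "(x, y) \<in> E" and p: "p \<ge> 1" and \<xi>0: "\<xi> 0 = 0"
    and summ: "summable (\<lambda>n. \<bar>\<xi> (Suc n) - \<xi> n\<bar> powr p)"
    and W: "finite W"
  shows "(\<Sum>c\<in>W. \<bar>tree_coord \<xi> x c - tree_coord \<xi> y c\<bar> powr p)
    \<le> (\<Sum>n. \<bar>\<xi> (Suc n) - \<xi> n\<bar> powr p)"
proof -
  let ?e = "\<lambda>n. \<bar>\<xi> (Suc n) - \<xi> n\<bar> powr p"
  \<comment> \<open>The edge is oriented away from the root; the other orientation follows by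
    symmetry.\<close>
  have main: "(\<Sum>c\<in>W. \<bar>tree_coord \<xi> x c - tree_coord \<xi> y c\<bar> powr p) \<le> suminf ?e"
    if xy: "(x, y) \<in> E" and le: "d r x \<le> d r y" for x y
  proof -
    have V: "x \<in> V" "y \<in> V" using xy E_V by auto
    obtain A where A: "A \<in> P" "x \<in> A" "y \<in> A"
      and eq: "\<And>B. \<lbrakk>B \<in> P; B \<noteq> A\<rbrakk> \<Longrightarrow> proj B x = proj B y" using edge_piece[OF xy] by metis
    have heq: "height B x = height B y" if "B \<in> P" "B \<noteq> A" for B
      using eq[OF that] by (simp add: height_def)
    have hA: "d r x = entry_level A + height A x" "d r y = entry_level A + height A y"
      using entry_height A by auto
    have "d r y \<le> Suc (d r x)" using d_triangle[OF r V] d_edge[OF xy] by simp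
    then consider "d r y = d r x" | "d r y = Suc (d r x)" using le by linarith
    then show ?thesis
    proof cases
      case 1
      then have "nodes x = nodes y" using heq hA by (auto simp: nodes_def) metis+
      then have "tree_coord \<xi> x c = tree_coord \<xi> y c" for c
        using 1 by (simp add: tree_coord_def depth_def)
      then show ?thesis using summ by (simp add: suminf_nonneg)
    next
      case 2
      have "\<bar>tree_coord \<xi> x c - tree_coord \<xi> y c\<bar> powr p = (if c \<in> nodes x then ?e (depth x c) else 0)"
        for c
      proof (cases "c \<in> nodes x")
        case True
        then obtain B k where c: "c = (B, k)" "B \<in> P" "1 \<le> k" "k \<le> height B x"
          by (auto simp: nodes_def)
        then have "k \<le> height B y" using heq[of B] hA 2 by (cases "B = A") auto
        then have "c \<in> nodes y" using c by (simp add: nodes_def)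
        moreover have "depth y c = Suc (depth x c)"
          using node_level_le[OF V(1), of B k] True c 2 by (simp add: depth_def Suc_diff_le)
        ultimately show ?thesis using True by (simp add: tree_coord_def abs_minus_commute)
      next
        case False
        have "tree_coord \<xi> y c = 0"
        proof (cases "c \<in> nodes y")
          case True
          then obtain B k where c: "c = (B, k)" "B \<in> P" "1 \<le> k" "k \<le> height B y"
            by (auto simp: nodes_def)
          then have "B = A" using False heq[of B] by (auto simp: nodes_def)
          then have "k = height A y" using c False hA 2 by (auto simp: nodes_def)
          \<comment> \<open>The new node lies at the level of \<open>y\<close> itself.\<close>
          then have "depth y c = 0" using c \<open>B = A\<close> hA by (simp add: depth_def)
          then show ?thesis using \<xi>0 by (simp add: tree_coord_def)
        qed (simp add: tree_coord_def)
        then show ?thesis using False by (simp add: tree_coord_def)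
      qed
      then have "(\<Sum>c\<in>W. \<bar>tree_coord \<xi> x c - tree_coord \<xi> y c\<bar> powr p)
          = (\<Sum>c\<in>W \<inter> nodes x. ?e (depth x c))"
        using W by (simp add: sum.inter_restrict)
      \<comment> \<open>Depths are distinct on a branch, so each increment of \<open>\<xi>\<close>
        is counted at most once.\<close>
      also have "\<dots> = (\<Sum>n\<in>depth x ` (W \<inter> nodes x). ?e n)"
        using inj_on_subset[OF inj_on_depth[OF V(1)], of "W \<inter> nodes x"] by (simp add: sum.reindex)
      also have "\<dots> \<le> suminf ?e" using W summ by (intro sum_le_suminf) auto
      finally show ?thesis .
    qed
  qed
  show ?thesis
  proof (cases "d r x \<le> d r y")
    case False
    then show ?thesis using main[of y x] symD[OF symE xy] by (simp add: abs_minus_commute)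
  qed (use main xy in blast)
qed

text \<open>Telescoping along a geodesic of length \<open>n\<close> costs a factor
  \<open>n powr (p - 1)\<close> by Jensen's inequality, and its \<open>n\<close> edges contribute at
  most \<open>?K\<close> each.\<close>

lemma tree_coord_lipschitz:
  assumes x: "x \<in> V" and y: "y \<in> V" and p: "p \<ge> 1" and \<xi>0: "\<xi> 0 = 0"
    and summ: "summable (\<lambda>n. \<bar>\<xi> (Suc n) - \<xi> n\<bar> powr p)"
    and W: "finite W"
  shows "(\<Sum>c\<in>W. \<bar>tree_coord \<xi> x c - tree_coord \<xi> y c\<bar> powr p)
    \<le> (\<Sum>n. \<bar>\<xi> (Suc n) - \<xi> n\<bar> powr p) * real (d x y) powr p"
proof -
  let ?n = "d x y" and ?K = "\<Sum>n. \<bar>\<xi> (Suc n) - \<xi> n\<bar> powr p"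
  obtain g where g: "g 0 = x" "g ?n = y" "\<And>i. i < ?n \<Longrightarrow> (g i, g (Suc i)) \<in> E"
    using d_relpow[OF x y] unfolding relpow_fun_conv by blast
  define \<delta> where "\<delta> i c = \<bar>tree_coord \<xi> (g i) c - tree_coord \<xi> (g (Suc i)) c\<bar>" for i c
  have "(\<Sum>c\<in>W. \<bar>tree_coord \<xi> x c - tree_coord \<xi> y c\<bar> powr p)
      \<le> (\<Sum>c\<in>W. real ?n powr (p - 1) * (\<Sum>i<?n. \<delta> i c powr p))"
  proof (rule sum_mono)
    fix c
    have "tree_coord \<xi> x c - tree_coord \<xi> y c
        = (\<Sum>i<?n. tree_coord \<xi> (g i) c - tree_coord \<xi> (g (Suc i)) c)"
      unfolding sum_lessThan_telescope'[of "\<lambda>i. tree_coord \<xi> (g i) c"] g(1,2) ..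
    then have "\<bar>tree_coord \<xi> x c - tree_coord \<xi> y c\<bar> \<le> (\<Sum>i<?n. \<delta> i c)"
      unfolding \<delta>_def by (simp only: sum_abs)
    then have "\<bar>tree_coord \<xi> x c - tree_coord \<xi> y c\<bar> powr p \<le> (\<Sum>i<?n. \<delta> i c) powr p"
      using p by (intro powr_mono2) auto
    also have "\<dots> \<le> real ?n powr (p - 1) * (\<Sum>i<?n. \<delta> i c powr p)"
      using sum_powr_le_card_powr_sum[OF p, of "{..<?n}" "\<lambda>i. \<delta> i c"] by (simp add: \<delta>_def)
    finally show "\<bar>tree_coord \<xi> x c - tree_coord \<xi> y c\<bar> powr p
        \<le> real ?n powr (p - 1) * (\<Sum>i<?n. \<delta> i c powr p)" .
  qed
  also have "\<dots> = real ?n powr (p - 1) * (\<Sum>i<?n. \<Sum>c\<in>W. \<delta> i c powr p)"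
    unfolding sum.swap[of _ "{..<?n}" W] sum_distrib_left ..
  also have "\<dots> \<le> real ?n powr (p - 1) * (\<Sum>i<?n. ?K)"
    unfolding \<delta>_def using tree_coord_edge[OF g(3) p \<xi>0 summ W]
    by (intro mult_left_mono sum_mono) auto
  also have "\<dots> = ?K * real ?n powr p" by (cases "?n = 0") (simp_all add: powr_diff)
  finally show ?thesis .
qed

end

section \<open>Embedding into \<open>\<ell>\<^sup>p\<close>\<close>

text \<open>Supports are countable, so a coordinate is coded by a vertex whose image has it in its
  support and by its number in that support. This fits any index type into vertices paired with
  naturals.\<close>

lemma lp_reindex:
  fixes \<phi> :: "'v \<Rightarrow> 'c \<Rightarrow> real"
  assumes \<phi>: "\<And>x. x \<in> V \<Longrightarrow> \<phi> x \<in> lp_space UNIV p"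
  obtains S :: "('v \<times> nat) set" and \<phi>' where
    "\<And>x. x \<in> V \<Longrightarrow> \<phi>' x \<in> lp_space S p"
    "\<And>x y. \<lbrakk>x \<in> V; y \<in> V\<rbrakk> \<Longrightarrow> lp_norm S p (\<phi>' x - \<phi>' y) = lp_norm UNIV p (\<phi> x - \<phi> y)"
proof -
  define supp where "supp x = {c. \<phi> x c \<noteq> 0}" for x
  define T where "T = (\<Union>x\<in>V. supp x)"
  define owner where "owner c = (SOME x. x \<in> V \<and> c \<in> supp x)" for c
  define j where "j c = (owner c, to_nat_on (supp (owner c)) c)" for c
  have owner: "owner c \<in> V \<and> c \<in> supp (owner c)" if "c \<in> T" for c
    unfolding owner_def by (rule someI_ex) (use that in \<open>auto simp: T_def\<close>)
  have count: "countable (supp x)" if "x \<in> V" for x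
    using \<phi>[OF that] by (simp add: lp_space_def supp_def)
  have inj: "inj_on j T"
  proof (rule inj_onI)
    fix c c' assume "c \<in> T" "c' \<in> T" "j c = j c'"
    then show "c = c'" using owner count inj_on_to_nat_on[of "supp (owner c)"]
      by (auto simp: j_def dest: inj_onD) (metis inj_onD)
  qed
  define \<phi>' where "\<phi>' x s = (if s \<in> j ` T then \<phi> x (inv_into T j s) else 0)" for x s
  have \<phi>'_j: "\<phi>' x (j c) = \<phi> x c" if "c \<in> T" for x c
    using that inj by (simp add: \<phi>'_def)
  have outside: "\<phi> x c = 0" if "x \<in> V" "c \<notin> T" for x c
    using that by (auto simp: T_def supp_def)
  have "\<phi>' x \<in> lp_space (j ` T) p" if x: "x \<in> V" for x
  proof -
    have "{s. \<phi>' x s \<noteq> 0} \<subseteq> j ` supp x"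
      using \<phi>'_j by (auto simp: \<phi>'_def supp_def split: if_splits)
    then have "countable {s. \<phi>' x s \<noteq> 0}" using count[OF x] by (meson countable_image countable_subset)
    moreover have "(\<lambda>c. \<bar>\<phi> x c\<bar> powr p) summable_on T"
      using \<phi>[OF x] by (auto simp: lp_space_def intro: summable_on_subset_banach)
    then have "(\<lambda>s. \<bar>\<phi>' x s\<bar> powr p) summable_on j ` T"
      using \<phi>'_j inj by (subst summable_on_reindex) (auto simp: o_def cong: summable_on_cong)
    ultimately show ?thesis by (simp add: lp_space_def \<phi>'_def)
  qed
  moreover have "lp_norm (j ` T) p (\<phi>' x - \<phi>' y) = lp_norm UNIV p (\<phi> x - \<phi> y)"
    if "x \<in> V" "y \<in> V" for x y
  proof -
    have "(\<Sum>\<^sub>\<infinity>s\<in>j ` T. \<bar>\<phi>' x s - \<phi>' y s\<bar> powr p) = (\<Sum>\<^sub>\<infinity>c\<in>T. \<bar>\<phi> x c - \<phi> y c\<bar> powr p)"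
      using \<phi>'_j inj by (subst infsum_reindex) (auto simp: o_def cong: infsum_cong)
    also have "\<dots> = (\<Sum>\<^sub>\<infinity>c. \<bar>\<phi> x c - \<phi> y c\<bar> powr p)"
      using outside that by (intro infsum_cong_neutral) auto
    finally show ?thesis by (simp add: lp_norm_def)
  qed
  ultimately show thesis using that by blast
qed

text \<open>The bounds are stated for \<open>p\<close>-th powers of norms, summed over the whole
  index type. The factor \<open>M\<close> leaves room to stretch the maps on the two-point
  pieces.\<close>

locale embedded_piece_graph = rooted_piece_graph V E P r
  for V :: "'v set" and E :: "('v \<times> 'v) set" and P :: "'v set set" and r :: 'v +
  fixes p :: real and \<Psi> :: "'v set \<Rightarrow> 'v \<Rightarrow> 'x \<Rightarrow> real" and g :: "nat \<Rightarrow> real" and M :: real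
  assumes p: "p \<ge> 1" and M: "M \<ge> 0"
    and g: "concave_fun g" "g 0 = 0"
    and \<Psi>_countable: "\<lbrakk>A \<in> P; u \<in> A\<rbrakk> \<Longrightarrow> countable {s. \<Psi> A u s \<noteq> 0}"
    and \<Psi>_summable: "\<lbrakk>A \<in> P; u \<in> A; w \<in> A\<rbrakk> \<Longrightarrow> (\<lambda>s. \<bar>\<Psi> A u s - \<Psi> A w s\<bar> powr p) summable_on UNIV"
    and \<Psi>_lower: "\<lbrakk>A \<in> P; u \<in> A; w \<in> A\<rbrakk> \<Longrightarrow> g (d u w) powr p \<le> (\<Sum>\<^sub>\<infinity>s. \<bar>\<Psi> A u s - \<Psi> A w s\<bar> powr p)"
    and \<Psi>_upper: "\<lbrakk>A \<in> P; u \<in> A; w \<in> A\<rbrakk> \<Longrightarrow> (\<Sum>\<^sub>\<infinity>s. \<bar>\<Psi> A u s - \<Psi> A w s\<bar> powr p) \<le> (M * d u w) powr p"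
begin

text \<open>Subtracting the value at the projection of the root leaves only the pieces in
  \<open>sep x r\<close>, which are finitely many.\<close>

definition piece_coord :: "'v \<Rightarrow> 'v set \<times> 'x \<Rightarrow> real" where
  "piece_coord x c = (if fst c \<in> P
     then \<Psi> (fst c) (proj (fst c) x) (snd c) - \<Psi> (fst c) (proj (fst c) r) (snd c) else 0)"

definition embed :: "(nat \<Rightarrow> real) \<Rightarrow> 'v \<Rightarrow> ('v set \<times> 'x) + ('v set \<times> nat) \<Rightarrow> real" where
  "embed \<xi> x = case_sum (piece_coord x) (tree_coord \<xi> x)"

definition piece_part :: "'v \<Rightarrow> 'v \<Rightarrow> real" where
  "piece_part x y = (\<Sum>A\<in>sep x y. \<Sum>\<^sub>\<infinity>s. \<bar>\<Psi> A (proj A x) s - \<Psi> A (proj A y) s\<bar> powr p)"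

definition tree_part :: "(nat \<Rightarrow> real) \<Rightarrow> 'v \<Rightarrow> 'v \<Rightarrow> real" where
  "tree_part \<xi> x y = (\<Sum>c\<in>nodes x \<union> nodes y. \<bar>tree_coord \<xi> x c - tree_coord \<xi> y c\<bar> powr p)"

text \<open>Coordinates of \<open>x\<close> and \<open>y\<close> agree off the pieces in
  \<open>sep x y\<close>, so the sum splits into finitely many sums over single pieces.\<close>

lemma has_sum_piece_coord:
  assumes x: "x \<in> V" and y: "y \<in> V"
  shows "((\<lambda>c. \<bar>piece_coord x c - piece_coord y c\<bar> powr p) has_sum piece_part x y) UNIV"
proof -
  let ?f = "\<lambda>c. \<bar>piece_coord x c - piece_coord y c\<bar> powr p"
  have "(?f has_sum piece_part x y) (\<Union>A\<in>sep x y. Pair A ` UNIV)"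
    unfolding piece_part_def
  proof (rule sum_has_sum)
    show "finite (sep x y)" using dist_sum_pieces x y by simp
    fix A assume "A \<in> sep x y"
    then have A: "A \<in> P" by (simp add: sep_def)
    then have "((\<lambda>s. \<bar>\<Psi> A (proj A x) s - \<Psi> A (proj A y) s\<bar> powr p) has_sum
        (\<Sum>\<^sub>\<infinity>s. \<bar>\<Psi> A (proj A x) s - \<Psi> A (proj A y) s\<bar> powr p)) UNIV"
      using \<Psi>_summable proj_in x y by simp
    then show "(?f has_sum (\<Sum>\<^sub>\<infinity>s. \<bar>\<Psi> A (proj A x) s - \<Psi> A (proj A y) s\<bar> powr p)) (Pair A ` UNIV)"
      using A by (subst has_sum_reindex) (auto simp: o_def piece_coord_def inj_on_def)
  qed auto
  then show ?thesis
    by (subst has_sum_cong_neutral[where S = UNIV and T = "\<Union>A\<in>sep x y. Pair A ` UNIV" and g = ?f])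
      (auto simp: piece_coord_def sep_def)
qed

lemma has_sum_tree_coord:
  assumes "x \<in> V" "y \<in> V"
  shows "((\<lambda>c. \<bar>tree_coord \<xi> x c - tree_coord \<xi> y c\<bar> powr p) has_sum tree_part \<xi> x y) UNIV"
  unfolding tree_part_def using finite_nodes assms
  by (intro has_sum_finite_neutralI[of "nodes x \<union> nodes y"]) (auto simp: tree_coord_def)

lemma has_sum_embed:
  assumes "x \<in> V" "y \<in> V"
  shows "((\<lambda>c. \<bar>embed \<xi> x c - embed \<xi> y c\<bar> powr p) has_sum (piece_part x y + tree_part \<xi> x y)) UNIV"
  unfolding UNIV_sum
  using has_sum_piece_coord[OF assms] has_sum_tree_coord[OF assms, of \<xi>]
  by (intro has_sum_Un_disjoint) (auto simp: has_sum_reindex o_def embed_def)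

lemma embed_root [simp]: "embed \<xi> r = (\<lambda>_. 0)"
proof -
  have "nodes r = {}" using r node_sep by fastforce
  then show ?thesis by (auto simp: embed_def piece_coord_def tree_coord_def fun_eq_iff split: sum.split)
qed

lemma embed_in_lp_space:
  assumes x: "x \<in> V"
  shows "embed \<xi> x \<in> lp_space UNIV p"
proof -
  have "{c. embed \<xi> x c \<noteq> 0} \<subseteq> Inl ` (SIGMA A:sep x r. {s. \<Psi> A (proj A x) s \<noteq> 0} \<union> {s. \<Psi> A (proj A r) s \<noteq> 0})
      \<union> Inr ` nodes x"
    by (force simp: embed_def piece_coord_def tree_coord_def sep_def split: sum.splits if_splits)
  moreover have "countable (SIGMA A:sep x r. {s. \<Psi> A (proj A x) s \<noteq> 0} \<union> {s. \<Psi> A (proj A r) s \<noteq> 0})"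
    using dist_sum_pieces[OF r x] \<Psi>_countable proj_in x r
    by (intro countable_SIGMA countable_finite[of "sep x r"]) (auto simp: sep_def)
  moreover have "countable (nodes x)" using finite_nodes[OF x] by (rule countable_finite)
  ultimately have "countable {c. embed \<xi> x c \<noteq> 0}"
    by (meson countable_Un countable_image countable_subset)
  \<comment> \<open>The root is mapped to zero, so this is \<open>has_sum_embed\<close> for
    \<open>x\<close> and \<open>r\<close>.\<close>
  moreover have "(\<lambda>c. \<bar>embed \<xi> x c\<bar> powr p) summable_on UNIV"
    using has_sum_imp_summable[OF has_sum_embed[OF x r]] by simp
  ultimately show ?thesis by (simp add: lp_space_def)
qed

lemma lp_norm_embed:
  assumes "x \<in> V" "y \<in> V"
  shows "lp_norm UNIV p (embed \<xi> x - embed \<xi> y) = (piece_part x y + tree_part \<xi> x y) powr (1 / p)"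
  using infsumI[OF has_sum_embed[OF assms]] by (simp add: lp_norm_def)

lemma tree_part_nonneg: "tree_part \<xi> x y \<ge> 0"
  unfolding tree_part_def by (intro sum_nonneg) auto

lemma piece_part_nonneg: "piece_part x y \<ge> 0"
  unfolding piece_part_def by (intro sum_nonneg infsum_nonneg) auto

lemma piece_part_upper:
  assumes x: "x \<in> V" and y: "y \<in> V"
  shows "piece_part x y \<le> (M * d x y) powr p"
proof -
  have "piece_part x y \<le> (\<Sum>A\<in>sep x y. (M * d (proj A x) (proj A y)) powr p)"
    unfolding piece_part_def using \<Psi>_upper proj_in x y by (intro sum_mono) (auto simp: sep_def)
  also have "\<dots> \<le> (\<Sum>A\<in>sep x y. M * d (proj A x) (proj A y)) powr p"
    using dist_sum_pieces[OF y x] M by (intro sum_powr_le_powr_sum p) auto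
  also have "(\<Sum>A\<in>sep x y. M * d (proj A x) (proj A y)) = M * d x y"
    using dist_sum_pieces[OF y x] by (simp flip: sum_distrib_left)
  finally show ?thesis .
qed

lemma lp_norm_embed_upper:
  assumes x: "x \<in> V" and y: "y \<in> V" and \<xi>0: "\<xi> 0 = 0"
    and summ: "summable (\<lambda>n. \<bar>\<xi> (Suc n) - \<xi> n\<bar> powr p)"
  shows "lp_norm UNIV p (embed \<xi> x - embed \<xi> y)
    \<le> (M powr p + (\<Sum>n. \<bar>\<xi> (Suc n) - \<xi> n\<bar> powr p)) powr (1 / p) * d x y"
proof -
  let ?K = "\<Sum>n. \<bar>\<xi> (Suc n) - \<xi> n\<bar> powr p"
  have "tree_part \<xi> x y \<le> ?K * real (d x y) powr p"
    unfolding tree_part_def using tree_coord_lipschitz[OF x y p \<xi>0 summ] finite_nodes x y by simp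
  then have "piece_part x y + tree_part \<xi> x y \<le> (M powr p + ?K) * real (d x y) powr p"
    using piece_part_upper[OF x y] M by (simp add: powr_mult algebra_simps)
  then have "(piece_part x y + tree_part \<xi> x y) powr (1 / p) \<le> ((M powr p + ?K) * real (d x y) powr p) powr (1 / p)"
    using p piece_part_nonneg[of x y] tree_part_nonneg[of \<xi> x y] by (intro powr_mono2) auto
  also have "\<dots> = (M powr p + ?K) powr (1 / p) * d x y"
    using p summ by (simp add: powr_mult powr_powr suminf_nonneg)
  finally show ?thesis using lp_norm_embed x y by simp
qed

lemma powr_le_imp_le_lp_norm:
  assumes "x \<in> V" "y \<in> V" "g n powr p \<le> piece_part x y + tree_part \<xi> x y"
  shows "g n \<le> lp_norm UNIV p (embed \<xi> x - embed \<xi> y)"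
proof -
  have "(g n powr p) powr (1 / p) \<le> (piece_part x y + tree_part \<xi> x y) powr (1 / p)"
    using assms p by (intro powr_mono2) auto
  then show ?thesis
    using assms p concave_fun_nonneg[OF g(1), of n] by (simp add: lp_norm_embed powr_powr)
qed

lemma lp_norm_embed_lower_1:
  assumes "p = 1" and x: "x \<in> V" and y: "y \<in> V"
  shows "g (d x y) \<le> lp_norm UNIV p (embed \<xi> x - embed \<xi> y)"
proof -
  have "g (d x y) \<le> (\<Sum>A\<in>sep x y. g (d (proj A x) (proj A y)))"
    using concave_fun_sum[OF g, of "sep x y" "\<lambda>A. d (proj A x) (proj A y)"] dist_sum_pieces[OF y x] by simp
  also have "\<dots> \<le> piece_part x y"
    unfolding piece_part_def
  proof (rule sum_mono)
    fix A assume "A \<in> sep x y"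
    then show "g (d (proj A x) (proj A y)) \<le> (\<Sum>\<^sub>\<infinity>s. \<bar>\<Psi> A (proj A x) s - \<Psi> A (proj A y) s\<bar> powr p)"
      using \<Psi>_lower[of A "proj A x" "proj A y"] proj_in x y concave_fun_nonneg[OF g(1)] \<open>p = 1\<close>
      by (simp add: sep_def)
  qed
  finally have "g (d x y) powr p \<le> piece_part x y + tree_part \<xi> x y"
    using tree_part_nonneg[of \<xi> x y] concave_fun_nonneg[OF g(1)] \<open>p = 1\<close> by simp
  then show ?thesis using powr_le_imp_le_lp_norm x y by simp
qed

text \<open>Subadditivity is applied to \<open>dist_le_branches\<close>. Each of the two branches
  costs \<open>2 * ?N + g 1\<close> and the branching piece costs \<open>?N\<close>, whence the 5
  and the 2.\<close>

lemma lp_norm_embed_lower: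
  assumes x: "x \<in> V" and y: "y \<in> V" and mono: "mono \<xi>" and \<xi>0: "\<xi> 0 = 0"
    and ge: "\<And>n. g n powr p \<le> real n * \<xi> n powr p"
  shows "g (d x y) \<le> 5 * lp_norm UNIV p (embed \<xi> x - embed \<xi> y) + 2 * g 1"
proof -
  let ?N = "lp_norm UNIV p (embed \<xi> x - embed \<xi> y)"
  obtain D where D: "d x y \<le> card (nodes x - nodes y) + card (nodes y - nodes x) + D"
    "D = 0 \<or> (\<exists>J\<in>sep x y. D = d (proj J x) (proj J y))"
    using dist_le_branches[OF x y] by metis
  have N: "?N \<ge> 0" by (simp add: lp_norm_def)
  have branch: "g n \<le> 2 * ?N + g 1"
    if n: "n = card (nodes u - nodes v)" and uv: "(u, v) = (x, y) \<or> (u, v) = (y, x)" for n u v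
  proof -
    have "u \<in> V" using uv x y by auto
    then have "g (n div 2) powr p \<le> (\<Sum>c\<in>nodes u - nodes v. \<bar>tree_coord \<xi> u c - tree_coord \<xi> v c\<bar> powr p)"
      using tree_coord_ge[OF _ p mono \<xi>0 ge] n by simp
    also have "\<dots> = (\<Sum>c\<in>nodes u - nodes v. \<bar>tree_coord \<xi> x c - tree_coord \<xi> y c\<bar> powr p)"
      using uv by (auto simp: abs_minus_commute)
    also have "\<dots> \<le> tree_part \<xi> x y"
      unfolding tree_part_def using finite_nodes x y uv by (intro sum_mono2) auto
    finally have "g (n div 2) \<le> ?N"
      using powr_le_imp_le_lp_norm[OF x y] piece_part_nonneg[of x y] by simp
    \<comment> \<open>The extra 1 covers odd \<open>n\<close> and is the source of the term
      \<open>g 1\<close>.\<close>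
    moreover have "g n \<le> g (n div 2 + n div 2 + 1)" by (intro concave_fun_mono[OF g(1)]) simp
    moreover have "\<dots> \<le> g (n div 2) + g (n div 2) + g 1"
      using concave_fun_subadditive[OF g(1), of "n div 2 + n div 2" 1]
        concave_fun_subadditive[OF g(1), of "n div 2" "n div 2"] by simp
    ultimately show ?thesis by simp
  qed
  have "g D \<le> ?N"
  proof (cases "D = 0")
    case True then show ?thesis using g N by simp
  next
    case False
    then obtain J where J: "J \<in> sep x y" "D = d (proj J x) (proj J y)" using D by blast
    then have "g D powr p \<le> (\<Sum>\<^sub>\<infinity>s. \<bar>\<Psi> J (proj J x) s - \<Psi> J (proj J y) s\<bar> powr p)"
      using \<Psi>_lower proj_in x y by (simp add: sep_def)
    also have "\<dots> \<le> piece_part x y"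
      unfolding piece_part_def using J dist_sum_pieces[OF y x]
      by (intro member_le_sum[of J _ "\<lambda>A. \<Sum>\<^sub>\<infinity>s. \<bar>\<Psi> A (proj A x) s - \<Psi> A (proj A y) s\<bar> powr p"])
        (auto intro: infsum_nonneg)
    finally show ?thesis using powr_le_imp_le_lp_norm[OF x y] tree_part_nonneg[of \<xi> x y] by simp
  qed
  moreover have "g (d x y) \<le> g (card (nodes x - nodes y) + card (nodes y - nodes x) + D)"
    using D by (intro concave_fun_mono[OF g(1)])
  moreover have "\<dots> \<le> g (card (nodes x - nodes y)) + g (card (nodes y - nodes x)) + g D"
    using concave_fun_subadditive[OF g(1), of "card (nodes x - nodes y) + card (nodes y - nodes x)" D]
      concave_fun_subadditive[OF g(1), of "card (nodes x - nodes y)" "card (nodes y - nodes x)"] by simp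
  ultimately show ?thesis using branch[of _ x y] branch[of _ y x] by simp
qed

end

section \<open>Reduction of tree-graded graphs to covers by pieces\<close>

definition bridge_pieces :: "('v \<times> 'v) set \<Rightarrow> 'i set \<Rightarrow> ('i \<Rightarrow> 'v set) \<Rightarrow> 'v set set" where
  "bridge_pieces E I PV = {{x, y} | x y. (x, y) \<in> E \<and> \<not> (\<exists>i\<in>I. x \<in> PV i \<and> y \<in> PV i)}"

text \<open>The ends of a bridge share no given piece, so a two-point piece meets every other piece
  in at most one vertex.\<close>

lemma tree_graded_piece_graph:
  fixes V :: "'v set"
  assumes tg: "tree_graded V E I PV PE"
  shows "piece_graph V E (PV ` I \<union> bridge_pieces E I PV)"
proof
  note tg' = tg[unfolded tree_graded_def]
  have sg: "simple_graph V E" and conn: "graph_connected V E" using tg' by simp_all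
  have sub: "subgraph (PV i) (PE i) V E" and ne: "PV i \<noteq> {}"
    and pconn: "graph_connected (PV i) (PE i)" if "i \<in> I" for i
    using tg' that by simp_all
  have inter: "a = b" if "i \<in> I" "j \<in> I" "i \<noteq> j" "a \<in> PV i \<inter> PV j" "b \<in> PV i \<inter> PV j" for i j a b
    using tg' that by (elim conjE) metis
  show EV: "E \<subseteq> V \<times> V" and symE: "sym E" using sg by (auto simp: simple_graph_def)
  have walk_rtrancl: "(x, y) \<in> F\<^sup>*" if W: "graph_connected W F" "x \<in> W" "y \<in> W"
    for W F and x y :: 'v
  proof -
    obtain xs where "walk W F xs" "hd xs = x" "last xs = y"
      using W unfolding graph_connected_def by blast
    then show ?thesis using walk_imp_relpow[of W F xs "length xs - 1"]
      by (auto simp: walk_def intro: relpow_imp_rtrancl)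
  qed
  show "(x, y) \<in> E\<^sup>*" if "x \<in> V" "y \<in> V" for x y using walk_rtrancl[OF conn that] .
  fix A assume A: "A \<in> PV ` I \<union> bridge_pieces E I PV"
  show "A \<subseteq> V" using A sub EV by (auto simp: subgraph_def bridge_pieces_def)
  show "A \<noteq> {}" using A ne unfolding bridge_pieces_def by blast
  show "(x, y) \<in> (E \<inter> A \<times> A)\<^sup>*" if xy: "x \<in> A" "y \<in> A" for x y
    using A
  proof
    assume "A \<in> PV ` I"
    then obtain i where i: "i \<in> I" "A = PV i" by blast
    then have "PE i \<subseteq> E \<inter> A \<times> A" using sub[OF i(1)] by (auto simp: subgraph_def simple_graph_def)
    then show ?thesis using walk_rtrancl[OF pconn[OF i(1)], of x y] xy i rtrancl_mono by blast
  next
    assume "A \<in> bridge_pieces E I PV"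
    then obtain a b where ab: "A = {a, b}" "(a, b) \<in> E" by (auto simp: bridge_pieces_def)
    then have "(a, b) \<in> E \<inter> A \<times> A" "(b, a) \<in> E \<inter> A \<times> A" using symD[OF symE ab(2)] by auto
    moreover have "x = y \<or> (x, y) = (a, b) \<or> (x, y) = (b, a)" using xy ab by blast
    ultimately show ?thesis by (metis r_into_rtrancl rtrancl.rtrancl_refl)
  qed
  fix B assume B: "B \<in> PV ` I \<union> bridge_pieces E I PV"
  show "A = B" if "x \<in> A" "y \<in> A" "x \<in> B" "y \<in> B" "x \<noteq> y" for x y
  proof -
    have bridge: "C = {x, y} \<and> \<not> (\<exists>i\<in>I. x \<in> PV i \<and> y \<in> PV i)"
      if "C \<in> bridge_pieces E I PV" "x \<in> C" "y \<in> C" for C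
      using that \<open>x \<noteq> y\<close> by (auto simp: bridge_pieces_def)
    show ?thesis
    proof (cases "\<exists>i\<in>I. x \<in> PV i \<and> y \<in> PV i")
      case True
      then have "A \<in> PV ` I" "B \<in> PV ` I" using A B bridge that by blast+
      then obtain i j where ij: "i \<in> I" "A = PV i" "j \<in> I" "B = PV j" by blast
      then show ?thesis using inter[of i j x y] that by (cases "i = j") auto
    next
      case False
      then have "A \<in> bridge_pieces E I PV" "B \<in> bridge_pieces E I PV" using A B that by blast+
      then have "A = {x, y}" "B = {x, y}" using bridge that by blast+
      then show ?thesis by simp
    qed
  qed
next
  fix x y assume "(x, y) \<in> E"
  then show "\<exists>A\<in>PV ` I \<union> bridge_pieces E I PV. x \<in> A \<and> y \<in> A"
    by (cases "\<exists>i\<in>I. x \<in> PV i \<and> y \<in> PV i") (auto simp: bridge_pieces_def)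
next
  fix cs assume "simple_loop V E cs"
  then have "\<exists>i\<in>I. set cs \<subseteq> PV i \<and> loop_edges cs \<subseteq> PE i" using tg by (simp add: tree_graded_def)
  then show "\<exists>A\<in>PV ` I \<union> bridge_pieces E I PV. set cs \<subseteq> A" by blast
qed

text \<open>Given pieces keep their maps; a bridge is sent to two points at distance
  \<open>M\<close> on a single coordinate axis.\<close>

lemma tree_graded_embedding:
  fixes V :: "'v set" and I :: "'i set" and X :: "'i \<Rightarrow> 'x set" and \<psi> :: "'i \<Rightarrow> 'v \<Rightarrow> 'x \<Rightarrow> real"
  assumes tg: "tree_graded V E I PV PE" and p: "p \<ge> 1" and g: "concave_fun g" and r: "r \<in> V"
    and \<psi>_lp: "\<forall>i\<in>I. \<forall>x\<in>PV i. \<psi> i x \<in> lp_space (X i) p"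
    and \<psi>_bounds: "\<forall>i\<in>I. \<forall>x\<in>PV i. \<forall>y\<in>PV i.
         g (graph_dist V E x y) \<le> lp_norm (X i) p (\<psi> i x - \<psi> i y) \<and>
         lp_norm (X i) p (\<psi> i x - \<psi> i y) \<le> real (graph_dist V E x y)"
  obtains \<Psi> :: "'v set \<Rightarrow> 'v \<Rightarrow> 'x \<Rightarrow> real" and M
  where "embedded_piece_graph V E (PV ` I \<union> bridge_pieces E I PV) r p \<Psi> g M"
proof -
  let ?P = "PV ` I \<union> bridge_pieces E I PV"
  interpret piece_graph V E ?P using tree_graded_piece_graph[OF tg] .
  \<comment> \<open>At least 1 for the upper bound on the given pieces, and at least
    \<open>g 1\<close> for the lower bound on bridges.\<close>
  define M where "M = max 1 (g 1)"
  define idx where "idx A = (SOME i. i \<in> I \<and> PV i = A)" for A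
  \<comment> \<open>On a bridge an arbitrarily chosen end gets the value \<open>M\<close> and the
    other end 0; \<open>undefined\<close> serves as the name of the only coordinate.\<close>
  define \<Psi> where "\<Psi> A = (if A \<in> PV ` I then \<psi> (idx A)
    else (\<lambda>v s. if v = (SOME z. z \<in> A) \<and> s = undefined then M else 0))" for A
  have M: "M \<ge> 1" "M \<ge> g 1" by (auto simp: M_def)
  have idx: "idx A \<in> I \<and> PV (idx A) = A" if "A \<in> PV ` I" for A
    unfolding idx_def by (rule someI_ex) (use that in blast)
  have \<psi>_out: "\<psi> i u s = 0" if "i \<in> I" "u \<in> PV i" "s \<notin> X i" for i u s
    using \<psi>_lp that by (auto simp: lp_space_def)
  have \<psi>_summ: "(\<lambda>s. \<bar>\<psi> i u s - \<psi> i w s\<bar> powr p) summable_on UNIV"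
    if i: "i \<in> I" "u \<in> PV i" "w \<in> PV i" for i u w
  proof -
    have "(\<lambda>s. 2 powr (p - 1) * (\<bar>\<psi> i u s\<bar> powr p + \<bar>\<psi> i w s\<bar> powr p)) summable_on X i"
      using \<psi>_lp that by (intro summable_on_cmult_right summable_on_add) (auto simp: lp_space_def)
    then have "(\<lambda>s. \<bar>\<psi> i u s - \<psi> i w s\<bar> powr p) summable_on X i"
      using abs_diff_powr_le[OF p] by (rule summable_on_comparison_test) auto
    then show ?thesis
      using \<psi>_out i by (subst summable_on_cong_neutral[where T = "X i" and g = "\<lambda>s. \<bar>\<psi> i u s - \<psi> i w s\<bar> powr p"]) auto
  qed
  have \<psi>_norm: "lp_norm (X i) p (\<psi> i u - \<psi> i w) powr p = (\<Sum>\<^sub>\<infinity>s. \<bar>\<psi> i u s - \<psi> i w s\<bar> powr p)"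
    if i: "i \<in> I" "u \<in> PV i" "w \<in> PV i" for i u w
  proof -
    have "(\<Sum>\<^sub>\<infinity>s\<in>X i. \<bar>\<psi> i u s - \<psi> i w s\<bar> powr p) = (\<Sum>\<^sub>\<infinity>s. \<bar>\<psi> i u s - \<psi> i w s\<bar> powr p)"
      using \<psi>_out i by (intro infsum_cong_neutral) auto
    then show ?thesis using p by (simp add: lp_norm_def powr_powr infsum_nonneg)
  qed
  \<comment> \<open>The lower bound at equal vertices, in a piece containing \<open>r\<close>,
    compares \<open>g 0\<close> with the norm of zero.\<close>
  have g0: "g 0 = 0"
  proof -
    have "\<forall>v\<in>V. \<exists>i\<in>I. v \<in> PV i" using tg by (simp add: tree_graded_def)
    then obtain i where i: "i \<in> I" "r \<in> PV i" using r by blast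
    then have "g (d r r) \<le> lp_norm (X i) p (\<psi> i r - \<psi> i r)" using \<psi>_bounds by blast
    then have "g 0 \<le> lp_norm (X i) p (\<psi> i r - \<psi> i r)" using r by simp
    then show ?thesis using concave_fun_nonneg[OF g, of 0] by (simp add: lp_norm_def)
  qed
  have bridge: "\<exists>z. \<Psi> A = (\<lambda>v s. if v = z \<and> s = undefined then M else 0)
      \<and> (\<forall>u\<in>A. \<forall>w\<in>A. u \<noteq> w \<longrightarrow> d u w = 1 \<and> (u = z \<longleftrightarrow> w \<noteq> z))"
    if A: "A \<in> ?P" "A \<notin> PV ` I" for A
  proof -
    obtain x y where xy: "A = {x, y}" "(x, y) \<in> E" using A by (auto simp: bridge_pieces_def)
    define z where "z = (SOME z. z \<in> A)"
    have "z \<in> A" unfolding z_def some_in_eq using xy by simp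
    have "d u w = 1" if "u \<in> A" "w \<in> A" "u \<noteq> w" for u w
    proof -
      have "(u, w) \<in> E" using xy that symD[OF symE xy(2)] by auto
      then have "d u w \<le> 1" "u \<in> V" "w \<in> V" using d_edge E_V by auto
      then show ?thesis using d_eq_0[of u w] that by (simp add: le_Suc_eq)
    qed
    moreover have "u = z \<longleftrightarrow> w \<noteq> z" if "u \<in> A" "w \<in> A" "u \<noteq> w" for u w
      using that \<open>z \<in> A\<close> xy(1) by blast
    moreover have "\<Psi> A = (\<lambda>v s. if v = z \<and> s = undefined then M else 0)"
      unfolding \<Psi>_def z_def using A(2) by (simp only: if_False)
    ultimately show ?thesis by blast
  qed
  have bridge_has_sum: "((\<lambda>s. \<bar>\<Psi> A u s - \<Psi> A w s\<bar> powr p) has_sum (M * d u w) powr p) UNIV"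
    and bridge_lower: "g (d u w) \<le> M * d u w"
    if A: "A \<in> ?P" "A \<notin> PV ` I" and u: "u \<in> A" and w: "w \<in> A" for A u w
  proof -
    obtain z where z: "\<Psi> A = (\<lambda>v s. if v = z \<and> s = undefined then M else 0)"
      and d1: "u \<noteq> w \<Longrightarrow> d u w = 1 \<and> (u = z \<longleftrightarrow> w \<noteq> z)"
      using bridge[OF A] u w by blast
    have d0: "d u u = 0" using piece_V[OF A(1)] u by auto
    show "((\<lambda>s. \<bar>\<Psi> A u s - \<Psi> A w s\<bar> powr p) has_sum (M * d u w) powr p) UNIV"
    proof (cases "u = w")
      case True
      then show ?thesis using d0 by simp
    next
      case False
      then have "\<bar>\<Psi> A u s - \<Psi> A w s\<bar> powr p = (if s = undefined then (M * d u w) powr p else 0)" for s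
        using d1 z M by (cases "u = z") auto
      then show ?thesis by (intro has_sum_finite_neutralI[of "{undefined}"]) auto
    qed
    show "g (d u w) \<le> M * d u w" using d0 d1 M g0 by (cases "u = w") auto
  qed
  have "embedded_piece_graph V E ?P r p \<Psi> g M"
  proof
    show "r \<in> V" "1 \<le> p" "0 \<le> M" "concave_fun g" "g 0 = 0" using r p M g g0 by auto
    fix A u assume A: "A \<in> ?P" and u: "u \<in> A"
    show "countable {s. \<Psi> A u s \<noteq> 0}"
    proof (cases "A \<in> PV ` I")
      case True
      then show ?thesis using idx[OF True] \<psi>_lp u by (auto simp: \<Psi>_def lp_space_def)
    next
      case False
      then have "{s. \<Psi> A u s \<noteq> 0} \<subseteq> {undefined}" by (auto simp: \<Psi>_def)
      then show ?thesis by (rule countable_subset) simp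
    qed
    fix w assume w: "w \<in> A"
    let ?s = "\<Sum>\<^sub>\<infinity>s. \<bar>\<Psi> A u s - \<Psi> A w s\<bar> powr p"
    have "(\<lambda>s. \<bar>\<Psi> A u s - \<Psi> A w s\<bar> powr p) summable_on UNIV
      \<and> g (d u w) powr p \<le> ?s \<and> ?s \<le> (M * d u w) powr p"
    proof (cases "A \<in> PV ` I")
      case True
      let ?N = "lp_norm (X (idx A)) p (\<psi> (idx A) u - \<psi> (idx A) w)"
      have i: "idx A \<in> I" "u \<in> PV (idx A)" "w \<in> PV (idx A)" using idx[OF True] u w by auto
      have "?s = ?N powr p" using \<psi>_norm[OF i] True by (simp add: \<Psi>_def)
      moreover have N: "g (d u w) \<le> ?N" "?N \<le> d u w" using \<psi>_bounds i by auto
      moreover have "real (d u w) \<le> M * d u w" using M by (simp add: mult_le_cancel_right1)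
      ultimately show ?thesis
        using \<psi>_summ[OF i] True p concave_fun_nonneg[OF g]
        by (auto simp: \<Psi>_def lp_norm_def intro!: powr_mono2)
    next
      case False
      have hs: "((\<lambda>s. \<bar>\<Psi> A u s - \<Psi> A w s\<bar> powr p) has_sum (M * d u w) powr p) UNIV"
        using bridge_has_sum A False u w by blast
      have "g (d u w) \<le> M * d u w" using bridge_lower A False u w by blast
      then have "g (d u w) powr p \<le> (M * d u w) powr p"
        using p concave_fun_nonneg[OF g] by (intro powr_mono2) auto
      then show ?thesis using hs infsumI[OF hs] by (auto intro: has_sum_imp_summable)
    qed
    then show "(\<lambda>s. \<bar>\<Psi> A u s - \<Psi> A w s\<bar> powr p) summable_on UNIV"
      "g (d u w) powr p \<le> ?s" "?s \<le> (M * d u w) powr p" by auto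
  qed
  then show thesis by (rule that)
qed

theorem theorem4p2:
  fixes V :: "'v set" and E :: "('v \<times> 'v) set"
    and I :: "'i set" and PV :: "'i \<Rightarrow> 'v set" and PE :: "'i \<Rightarrow> ('v \<times> 'v) set"
    and p :: real and \<rho>' :: "nat \<Rightarrow> real"
    and X :: "'i \<Rightarrow> 'x set" and \<psi> :: "'i \<Rightarrow> 'v \<Rightarrow> 'x \<Rightarrow> real"
  assumes tg: "tree_graded V E I PV PE"
    and p: "p \<ge> 1"
    and conc: "concave_fun \<rho>'"
    and \<psi>_lp: "\<forall>i\<in>I. \<forall>x\<in>PV i. \<psi> i x \<in> lp_space (X i) p"
    and \<psi>_bounds: "\<forall>i\<in>I. \<forall>x\<in>PV i. \<forall>y\<in>PV i.
         \<rho>' (graph_dist V E x y) \<le> lp_norm (X i) p (\<psi> i x - \<psi> i y) \<and>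
         lp_norm (X i) p (\<psi> i x - \<psi> i y) \<le> real (graph_dist V E x y)"
  shows "(p = 1 \<longrightarrow>
            (\<exists>(S :: ('v \<times> nat) set) (\<phi> :: 'v \<Rightarrow> ('v \<times> nat) \<Rightarrow> real) (C :: real).
               (\<forall>x\<in>V. \<phi> x \<in> lp_space S 1) \<and>
               (\<forall>x\<in>V. \<forall>y\<in>V.
                  \<rho>' (graph_dist V E x y) \<le> C * lp_norm S 1 (\<phi> x - \<phi> y) + C \<and>
                  lp_norm S 1 (\<phi> x - \<phi> y) \<le> C * real (graph_dist V E x y) + C))) \<and>
         (p > 1 \<longrightarrow>
            (\<forall>f. cond_Cp p f \<longrightarrow>
              (\<exists>(S :: ('v \<times> nat) set) (\<phi> :: 'v \<Rightarrow> ('v \<times> nat) \<Rightarrow> real) (C :: real).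
                 (\<forall>x\<in>V. \<phi> x \<in> lp_space S p) \<and>
                 (\<forall>x\<in>V. \<forall>y\<in>V.
                    min (\<rho>' (graph_dist V E x y)) (f (graph_dist V E x y))
                      \<le> C * lp_norm S p (\<phi> x - \<phi> y) + C \<and>
                    lp_norm S p (\<phi> x - \<phi> y) \<le> C * real (graph_dist V E x y) + C))))"
proof (cases "V = {}")
  case True
  \<comment> \<open>Without vertices there is no root to choose, and all conditions are
    vacuous.\<close>
  then show ?thesis by (intro conjI impI allI exI[of _ "{}"] exI[of _ "\<lambda>_ _. 0"]) auto
next
  case False
  then obtain r where r: "r \<in> V" by blast
  have package: "\<exists>(S :: ('v \<times> nat) set) \<phi> C. (\<forall>x\<in>V. \<phi> x \<in> lp_space S p) \<and>
      (\<forall>x\<in>V. \<forall>y\<in>V. h (graph_dist V E x y) \<le> C * lp_norm S p (\<phi> x - \<phi> y) + C \<and>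
        lp_norm S p (\<phi> x - \<phi> y) \<le> C * real (graph_dist V E x y) + C)"
    if \<phi>: "\<And>x. x \<in> V \<Longrightarrow> \<phi> x \<in> lp_space UNIV p"
      and low: "\<And>x y. \<lbrakk>x \<in> V; y \<in> V\<rbrakk> \<Longrightarrow> h (graph_dist V E x y) \<le> a * lp_norm UNIV p (\<phi> x - \<phi> y) + b"
      and up: "\<And>x y. \<lbrakk>x \<in> V; y \<in> V\<rbrakk> \<Longrightarrow> lp_norm UNIV p (\<phi> x - \<phi> y) \<le> c * graph_dist V E x y"
    for h :: "nat \<Rightarrow> real" and \<phi> :: "'v \<Rightarrow> ('v set \<times> 'x) + ('v set \<times> nat) \<Rightarrow> real" and a b c :: real
  proof -
    obtain S :: "('v \<times> nat) set" and \<phi>' where S: "\<And>x. x \<in> V \<Longrightarrow> \<phi>' x \<in> lp_space S p"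
      "\<And>x y. \<lbrakk>x \<in> V; y \<in> V\<rbrakk> \<Longrightarrow> lp_norm S p (\<phi>' x - \<phi>' y) = lp_norm UNIV p (\<phi> x - \<phi> y)"
      using lp_reindex[of V \<phi> p] \<phi> by metis
    define C where "C = \<bar>a\<bar> + \<bar>b\<bar> + \<bar>c\<bar>"
    have "h (graph_dist V E x y) \<le> C * lp_norm S p (\<phi>' x - \<phi>' y) + C \<and>
        lp_norm S p (\<phi>' x - \<phi>' y) \<le> C * real (graph_dist V E x y) + C"
      if xy: "x \<in> V" "y \<in> V" for x y
    proof -
      let ?N = "lp_norm UNIV p (\<phi> x - \<phi> y)"
      have "?N \<ge> 0" by (simp add: lp_norm_def)
      then have "a * ?N \<le> C * ?N" "c * graph_dist V E x y \<le> C * graph_dist V E x y"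
        by (auto simp: C_def intro!: mult_right_mono)
      moreover have "b \<le> C" "0 \<le> C" by (auto simp: C_def)
      ultimately show ?thesis using low[OF xy] up[OF xy] unfolding S(2)[OF xy] by (intro conjI) linarith+
    qed
    then show ?thesis using S(1) by blast
  qed
  show ?thesis
  proof (intro conjI impI allI)
    assume p1: "p = 1"
    obtain \<Psi> :: "'v set \<Rightarrow> 'v \<Rightarrow> 'x \<Rightarrow> real" and M
      where "embedded_piece_graph V E (PV ` I \<union> bridge_pieces E I PV) r p \<Psi> \<rho>' M"
      using tree_graded_embedding[OF tg p conc r \<psi>_lp \<psi>_bounds] .
    then interpret embedded_piece_graph V E "PV ` I \<union> bridge_pieces E I PV" r p \<Psi> \<rho>' M .
    \<comment> \<open>The zero weight switches the tree part off.\<close>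
    have "\<rho>' (d x y) \<le> 1 * lp_norm UNIV p (embed (\<lambda>_. 0) x - embed (\<lambda>_. 0) y) + 0"
      if "x \<in> V" "y \<in> V" for x y
      using lp_norm_embed_lower_1[OF p1 that] by simp
    note package[OF embed_in_lp_space this lp_norm_embed_upper]
    then show "\<exists>(S :: ('v \<times> nat) set) (\<phi> :: 'v \<Rightarrow> ('v \<times> nat) \<Rightarrow> real) (C :: real).
       (\<forall>x\<in>V. \<phi> x \<in> lp_space S 1) \<and>
       (\<forall>x\<in>V. \<forall>y\<in>V.
          \<rho>' (graph_dist V E x y) \<le> C * lp_norm S 1 (\<phi> x - \<phi> y) + C \<and>
          lp_norm S 1 (\<phi> x - \<phi> y) \<le> C * real (graph_dist V E x y) + C)"
      using p1 by simp
  next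
    fix f assume "p > 1" and f: "cond_Cp p f"
    \<comment> \<open>The minimum inherits (C_p) from \<open>f\<close> and the lower bound on pieces
      from \<open>\<rho>'\<close>, so one function serves both parts of the embedding.\<close>
    let ?g = "\<lambda>n. min (\<rho>' n) (f n)"
    have Cp: "cond_Cp p ?g" using cond_Cp_min[OF f conc p] .
    then have min_conc: "concave_fun ?g" by (simp add: cond_Cp_def)
    have bounds: "\<forall>i\<in>I. \<forall>x\<in>PV i. \<forall>y\<in>PV i.
         ?g (graph_dist V E x y) \<le> lp_norm (X i) p (\<psi> i x - \<psi> i y) \<and>
         lp_norm (X i) p (\<psi> i x - \<psi> i y) \<le> real (graph_dist V E x y)"
      using \<psi>_bounds by (meson min.coboundedI1)
    obtain \<Psi> :: "'v set \<Rightarrow> 'v \<Rightarrow> 'x \<Rightarrow> real" and M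
      where "embedded_piece_graph V E (PV ` I \<union> bridge_pieces E I PV) r p \<Psi> ?g M"
      using tree_graded_embedding[OF tg p min_conc r \<psi>_lp bounds] .
    then interpret embedded_piece_graph V E "PV ` I \<union> bridge_pieces E I PV" r p \<Psi> ?g M .
    let ?\<xi> = "level_weight p ?g"
    have "?\<xi> (Suc n) \<ge> ?\<xi> n" for n using level_weight_mono by (rule monoD) simp
    then have "summable (\<lambda>n. \<bar>?\<xi> (Suc n) - ?\<xi> n\<bar> powr p)"
      using Cp level_weight_increment[OF p min_conc] by (simp add: cond_Cp_def)
    note upper = lp_norm_embed_upper[OF _ _ level_weight_0 this]
    note lower = lp_norm_embed_lower[OF _ _ level_weight_mono level_weight_0 level_weight_ge[OF p min_conc g(2)]]
    show "\<exists>(S :: ('v \<times> nat) set) (\<phi> :: 'v \<Rightarrow> ('v \<times> nat) \<Rightarrow> real) (C :: real).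
       (\<forall>x\<in>V. \<phi> x \<in> lp_space S p) \<and>
       (\<forall>x\<in>V. \<forall>y\<in>V.
          min (\<rho>' (graph_dist V E x y)) (f (graph_dist V E x y))
            \<le> C * lp_norm S p (\<phi> x - \<phi> y) + C \<and>
          lp_norm S p (\<phi> x - \<phi> y) \<le> C * real (graph_dist V E x y) + C)"
      by (rule package[OF embed_in_lp_space lower upper])
  qed
qed

end
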